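(* Let $\mathbb{D}$ be a double category. The inclusion double functor $\mathrm{Inc}_{\mathbb{D}}\colon\mathbb{D}\to\mathbb{M}\mathrm{nd}(\mathbb{D})$, $I\mapsto(I,\mathrm{id}_I)$, admits a horizontal right double adjoint (i.e. $\mathbb{D}$ admits Eilenberg–Moore objects) if and only if the parameterized presheaf of algebra structures $$\text{-}\mathrm{Alg}_{-}:=\mathbb{M}\mathrm{nd}(\mathbb{D})(\mathrm{Inc}_{\mathbb{D}}-,-)\colon\mathbb{D}^{\mathrm{horop}}\times\mathbb{V}_1\mathbb{M}\mathrm{nd}(\mathbb{D})\to\mathbb{S}\mathrm{pan}^t,$$ which assigns to an object $I$ and a monad $(X,S)$ the set $S\text{-}\mathrm{Alg}_I$ of horizontal monad maps $(I,\mathrm{id}_I)\to(X,S)$, is representable, i.e. isomorphic as a parameterized presheaf to $\mathbb{D}(-,G-)$ for some double functor $G\colon\mathbb{V}_1\mathbb{M}\mathrm{nd}(\mathbb{D})\to\mathbb{D}$.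
   Context: **Double categories.** Double categories are strict (internal categories in $\mathbf{Cat}$): objects, horizontal morphisms, vertical morphisms, squares. $[\alpha\ \beta]$ denotes horizontal composition ($\alpha$ on the left; $[f\ g]=g\circ f$), $\begin{bmatrix}\alpha\\ \beta\end{bmatrix}$ vertical composition ($\alpha$ on top); $1^h_C,1^v_C$ are identity morphisms; $i^h_j$ is the horizontal identity square of a vertical morphism $j$, $i^v_f$ the vertical identity square of a horizontal morphism $f$. $\mathbb{D}(j,k)$ is the set of squares with left side $j$ and right side $k$. $\mathbb{D}^{\mathrm{horop}}$ reverses the horizontal direction. $\mathbb{V}_1\mathbb{D}$ has the same objects and vertical morphisms as $\mathbb{D}$ but only identity horizontal morphisms and trivial squares. **Horizontal double adjunction.** An adjunction in the 2-category of double categories, double functors and horizontal natural transformations. A horizontal natural transformation $\theta\colon F\Rightarrow G$ assigns to each object $A$ a horizontal morphism $\theta A\colon FA\to GA$ and to each vertical morphism $j\colon A\to C$ a square $\theta j$ with left $Fj$, right $Gj$, top $\theta A$, bottom $\theta C$, such that $\theta 1^v_A=i^v_{\theta A}$, $\theta\begin{bmatrix}j_1\\ j_2\end{bmatrix}=\begin{bmatrix}\theta j_1\\ \theta j_2\end{bmatrix}$ and $[F\alpha\ \theta k]=[\theta j\ G\alpha]$ for each square $\alpha\in\mathbb{D}(j,k)$. **Monads.** A monad $(X,S)$ in $\mathbb{D}$ is an object $X$, a horizontal morphism $S\colon X\to X$, and squares with identity vertical sides $\mu_S$ (top $[S\ S]$, bottom $S$), $\eta_S$ (top $1^h_X$,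 bottom $S$) satisfying associativity and unit laws. In the double category $\mathbb{M}\mathrm{nd}(\mathbb{D})$ a horizontal morphism $(F,\phi)\colon(X,P)\to(Y,Q)$ is a horizontal morphism $F\colon X\to Y$ with a square $\phi$ with identity vertical sides, top $[F\ Q]$, bottom $[P\ F]$, such that $\begin{bmatrix}[i^v_F\ \eta_Q]\\ \phi\end{bmatrix}=[\eta_P\ i^v_F]$ and $\begin{bmatrix}[i^v_F\ \mu_Q]\\ \phi\end{bmatrix}=\begin{bmatrix}[\phi\ i^v_Q]\\ [i^v_P\ \phi]\\ [\mu_P\ i^v_F]\end{bmatrix}$. A vertical morphism $(u,\bar u)\colon(X,P)\to(X',P')$ is a vertical morphism $u\colon X\to X'$ with a square $\bar u$ (top $P$, bottom $P'$, left and right $u$) such that $\begin{bmatrix}\eta_P\\ \bar u\end{bmatrix}=\begin{bmatrix}i^h_u\\ \eta_{P'}\end{bmatrix}$ and $\begin{bmatrix}\mu_P\\ \bar u\end{bmatrix}=\begin{bmatrix}[\bar u\ \bar u]\\ \mu_{P'}\end{bmatrix}$. A square with top $(F,\phi)$, bottom $(F',\phi')$, left $(u,\bar u)$, right $(v,\bar v)$ is a square $\alpha$ of $\mathbb{D}$ with top $F$, bottom $F'$, left $u$, right $v$ such that $\begin{bmatrix}\phi\\ [\bar u\ \alpha]\end{bmatrix}=\begin{bmatrix}[\alpha\ \bar v]\\ \phi'\end{bmatrix}$. $\mathrm{Inc}_{\mathbb{D}}$ sends $I$ to the identity monad $(I,1^h_I)$, $f$ to $(f,i^v_f)$, $u$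 to $(u,i^h_u)$, and a square to itself. **Parameterized presheaves.** $\mathbb{S}\mathrm{pan}^t$ has sets as objects, functions as horizontal morphisms, spans as (weakly associative, by pullback) vertical morphisms, morphisms of spans as squares. A presheaf on $\mathbb{D}$ parameterized by $\mathbb{E}$ is a vertically lax double functor $K\colon\mathbb{D}^{\mathrm{horop}}\times\mathbb{E}\to\mathbb{S}\mathrm{pan}^t$: sets $K(C)$ for objects $C$, functions $K(f)$ for horizontal morphisms, spans $K(C)\leftarrow K(j)\to K(C')$ for vertical $j\colon C\to C'$, morphisms of spans $K(\alpha)$ for squares, strictly functorial horizontally, with span maps $K(j)\times_{K(C')}K(k)\to K\left(\begin{bmatrix}j\\ k\end{bmatrix}\right)$ and $K(C)\to K(1^v_C)$, natural with respect to squares and horizontal morphisms, associative and unital. Morphisms of such presheaves are horizontal natural transformations: functions $K(C)\to L(C)$, $K(j)\to L(j)$ forming span morphisms, natural with respect to horizontal morphisms and squares, commuting with the comparison maps. For double functors $F\colon\mathbb{X}\to\mathbb{A}$ and $G\colon\mathbb{E}\to\mathbb{D}$, the parameterized presheaf $\mathbb{A}(F-,-)$ on $\mathbb{X}^{\mathrm{horop}}\times\mathbb{V}_1\mathbb{A}$ sends $(X,A)$ to the set of horizontal morphisms $FX\to A$ and vertical $(j,k)$ to the span given by $\mathbb{A}(Fj,k)$ with top and bottom boundary as legs; horizontal morphisms and squares act by horizontal composition; the comparison maps are vertical composition of squares and $f\mapsto i^v_f$. $\mathbb{D}(-,G-)$ is defined similarly on $\mathbb{D}^{\mathrm{horop}}\times\mathbb{E}$.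 *)

theory Defs
  imports Main
begin

text \<open>
  All structures live on explicit carriers. Composition is written in diagrammatic order
  throughout: \<open>hcomp D f g\<close> is [f g], i.e. g after f; \<open>beside D \<alpha> \<beta>\<close> is horizontal composition
  of squares (\<open>\<alpha>\<close> on the left), and \<open>above D \<alpha> \<beta>\<close> is vertical composition (\<open>\<alpha>\<close> on top).
\<close>

record ('o, 'h, 'v, 's) dcat =
  Obj :: "'o set"
  Hor :: "'h set"
  Ver :: "'v set"
  Sqr :: "'s set"
  hdom :: "'h \<Rightarrow> 'o"
  hcod :: "'h \<Rightarrow> 'o"
  vdom :: "'v \<Rightarrow> 'o"
  vcod :: "'v \<Rightarrow> 'o"
  sleft :: "'s \<Rightarrow> 'v"
  sright :: "'s \<Rightarrow> 'v"
  stop :: "'s \<Rightarrow> 'h"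
  sbot :: "'s \<Rightarrow> 'h"
  hid :: "'o \<Rightarrow> 'h"
  vid :: "'o \<Rightarrow> 'v"
  ih :: "'v \<Rightarrow> 's"
  iv :: "'h \<Rightarrow> 's"
  hcomp :: "'h \<Rightarrow> 'h \<Rightarrow> 'h"
  vcomp :: "'v \<Rightarrow> 'v \<Rightarrow> 'v"
  beside :: "'s \<Rightarrow> 's \<Rightarrow> 's"
  above :: "'s \<Rightarrow> 's \<Rightarrow> 's"

locale cat_structure =
  fixes Ob :: "'o set" and Ar :: "'a set"
    and dom :: "'a \<Rightarrow> 'o" and cod :: "'a \<Rightarrow> 'o"
    and idt :: "'o \<Rightarrow> 'a" and cmp :: "'a \<Rightarrow> 'a \<Rightarrow> 'a"
  assumes dom_cod: "f \<in> Ar \<Longrightarrow> dom f \<in> Ob \<and> cod f \<in> Ob"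
    and idt: "A \<in> Ob \<Longrightarrow> idt A \<in> Ar \<and> dom (idt A) = A \<and> cod (idt A) = A"
    and cmp: "\<lbrakk>f \<in> Ar; g \<in> Ar; cod f = dom g\<rbrakk>
      \<Longrightarrow> cmp f g \<in> Ar \<and> dom (cmp f g) = dom f \<and> cod (cmp f g) = cod g"
    and idt_cmp: "f \<in> Ar \<Longrightarrow> cmp (idt (dom f)) f = f"
    and cmp_idt: "f \<in> Ar \<Longrightarrow> cmp f (idt (cod f)) = f"
    and cmp_assoc: "\<lbrakk>f \<in> Ar; g \<in> Ar; k \<in> Ar; cod f = dom g; cod g = dom k\<rbrakk>
      \<Longrightarrow> cmp (cmp f g) k = cmp f (cmp g k)"

locale double_category =
  fixes D :: "('o, 'h, 'v, 's) dcat"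
  assumes hor_cat: "cat_structure (Obj D) (Hor D) (hdom D) (hcod D) (hid D) (hcomp D)"
    and ver_cat: "cat_structure (Obj D) (Ver D) (vdom D) (vcod D) (vid D) (vcomp D)"
    and sqr_hcat: "cat_structure (Ver D) (Sqr D) (sleft D) (sright D) (ih D) (beside D)"
    and sqr_vcat: "cat_structure (Hor D) (Sqr D) (stop D) (sbot D) (iv D) (above D)"
    and corners: "\<alpha> \<in> Sqr D \<Longrightarrow>
        vdom D (sleft D \<alpha>) = hdom D (stop D \<alpha>) \<and> vcod D (sleft D \<alpha>) = hdom D (sbot D \<alpha>) \<and>
        vdom D (sright D \<alpha>) = hcod D (stop D \<alpha>) \<and> vcod D (sright D \<alpha>) = hcod D (sbot D \<alpha>)"
    and ih_boundary: "j \<in> Ver D \<Longrightarrow>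
        stop D (ih D j) = hid D (vdom D j) \<and> sbot D (ih D j) = hid D (vcod D j)"
    and iv_boundary: "f \<in> Hor D \<Longrightarrow>
        sleft D (iv D f) = vid D (hdom D f) \<and> sright D (iv D f) = vid D (hcod D f)"
    and beside_boundary: "\<lbrakk>\<alpha> \<in> Sqr D; \<beta> \<in> Sqr D; sright D \<alpha> = sleft D \<beta>\<rbrakk> \<Longrightarrow>
        stop D (beside D \<alpha> \<beta>) = hcomp D (stop D \<alpha>) (stop D \<beta>) \<and>
        sbot D (beside D \<alpha> \<beta>) = hcomp D (sbot D \<alpha>) (sbot D \<beta>)"
    and above_boundary: "\<lbrakk>\<alpha> \<in> Sqr D; \<beta> \<in> Sqr D; sbot D \<alpha> = stop D \<beta>\<rbrakk> \<Longrightarrow>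
        sleft D (above D \<alpha> \<beta>) = vcomp D (sleft D \<alpha>) (sleft D \<beta>) \<and>
        sright D (above D \<alpha> \<beta>) = vcomp D (sright D \<alpha>) (sright D \<beta>)"
    and ih_vid: "A \<in> Obj D \<Longrightarrow> ih D (vid D A) = iv D (hid D A)"
    and ih_vcomp: "\<lbrakk>j \<in> Ver D; k \<in> Ver D; vcod D j = vdom D k\<rbrakk> \<Longrightarrow>
        ih D (vcomp D j k) = above D (ih D j) (ih D k)"
    and iv_hcomp: "\<lbrakk>f \<in> Hor D; g \<in> Hor D; hcod D f = hdom D g\<rbrakk> \<Longrightarrow>
        iv D (hcomp D f g) = beside D (iv D f) (iv D g)"
    and interchange: "\<lbrakk>\<alpha> \<in> Sqr D; \<beta> \<in> Sqr D; \<gamma> \<in> Sqr D; \<delta> \<in> Sqr D;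
        sright D \<alpha> = sleft D \<beta>; sright D \<gamma> = sleft D \<delta>;
        sbot D \<alpha> = stop D \<gamma>; sbot D \<beta> = stop D \<delta>\<rbrakk> \<Longrightarrow>
        above D (beside D \<alpha> \<beta>) (beside D \<gamma> \<delta>) = beside D (above D \<alpha> \<gamma>) (above D \<beta> \<delta>)"

definition horop :: "('o, 'h, 'v, 's) dcat \<Rightarrow> ('o, 'h, 'v, 's) dcat" where
  "horop D = D\<lparr>hdom := hcod D, hcod := hdom D, sleft := sright D, sright := sleft D,
     hcomp := (\<lambda>f g. hcomp D g f), beside := (\<lambda>\<alpha> \<beta>. beside D \<beta> \<alpha>)\<rparr>"

definition dprod ::
  "('o, 'h, 'v, 's) dcat \<Rightarrow> ('o2, 'h2, 'v2, 's2) dcat \<Rightarrow>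
    ('o \<times> 'o2, 'h \<times> 'h2, 'v \<times> 'v2, 's \<times> 's2) dcat" where
  "dprod D E = \<lparr>Obj = Obj D \<times> Obj E, Hor = Hor D \<times> Hor E, Ver = Ver D \<times> Ver E,
     Sqr = Sqr D \<times> Sqr E,
     hdom = map_prod (hdom D) (hdom E), hcod = map_prod (hcod D) (hcod E),
     vdom = map_prod (vdom D) (vdom E), vcod = map_prod (vcod D) (vcod E),
     sleft = map_prod (sleft D) (sleft E), sright = map_prod (sright D) (sright E),
     stop = map_prod (stop D) (stop E), sbot = map_prod (sbot D) (sbot E),
     hid = map_prod (hid D) (hid E), vid = map_prod (vid D) (vid E),
     ih = map_prod (ih D) (ih E), iv = map_prod (iv D) (iv E),
     hcomp = (\<lambda>(f, g) (f', g'). (hcomp D f f', hcomp E g g')),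
     vcomp = (\<lambda>(j, k) (j', k'). (vcomp D j j', vcomp E k k')),
     beside = (\<lambda>(\<alpha>, \<beta>) (\<alpha>', \<beta>'). (beside D \<alpha> \<alpha>', beside E \<beta> \<beta>')),
     above = (\<lambda>(\<alpha>, \<beta>) (\<alpha>', \<beta>'). (above D \<alpha> \<alpha>', above E \<beta> \<beta>'))\<rparr>"

text \<open>The double category \<open>\<V>\<^sub>1\<D>\<close>: the only squares retained are the horizontal
  identities of vertical morphisms.\<close>

definition V1 :: "('o, 'h, 'v, 's) dcat \<Rightarrow> ('o, 'h, 'v, 's) dcat" where
  "V1 D = D\<lparr>Hor := hid D ` Obj D, Sqr := ih D ` Ver D\<rparr>"

record ('o, 'h, 'v, 's, 'o2, 'h2, 'v2, 's2) dfun =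
  fob :: "'o \<Rightarrow> 'o2"
  fhor :: "'h \<Rightarrow> 'h2"
  fver :: "'v \<Rightarrow> 'v2"
  fsqr :: "'s \<Rightarrow> 's2"

locale double_functor = X: double_category X + A: double_category A
  for X :: "('o, 'h, 'v, 's) dcat" and A :: "('o2, 'h2, 'v2, 's2) dcat" +
  fixes F :: "('o, 'h, 'v, 's, 'o2, 'h2, 'v2, 's2) dfun"
  assumes fob: "C \<in> Obj X \<Longrightarrow> fob F C \<in> Obj A"
    and fhor: "f \<in> Hor X \<Longrightarrow> fhor F f \<in> Hor A \<and>
        hdom A (fhor F f) = fob F (hdom X f) \<and> hcod A (fhor F f) = fob F (hcod X f)"
    and fver: "j \<in> Ver X \<Longrightarrow> fver F j \<in> Ver A \<and>
        vdom A (fver F j) = fob F (vdom X j) \<and> vcod A (fver F j) = fob F (vcod X j)"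
    and fsqr: "\<alpha> \<in> Sqr X \<Longrightarrow> fsqr F \<alpha> \<in> Sqr A \<and>
        sleft A (fsqr F \<alpha>) = fver F (sleft X \<alpha>) \<and> sright A (fsqr F \<alpha>) = fver F (sright X \<alpha>) \<and>
        stop A (fsqr F \<alpha>) = fhor F (stop X \<alpha>) \<and> sbot A (fsqr F \<alpha>) = fhor F (sbot X \<alpha>)"
    and fhor_hid: "C \<in> Obj X \<Longrightarrow> fhor F (hid X C) = hid A (fob F C)"
    and fver_vid: "C \<in> Obj X \<Longrightarrow> fver F (vid X C) = vid A (fob F C)"
    and fsqr_ih: "j \<in> Ver X \<Longrightarrow> fsqr F (ih X j) = ih A (fver F j)"
    and fsqr_iv: "f \<in> Hor X \<Longrightarrow> fsqr F (iv X f) = iv A (fhor F f)"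
    and fhor_hcomp: "\<lbrakk>f \<in> Hor X; g \<in> Hor X; hcod X f = hdom X g\<rbrakk> \<Longrightarrow>
        fhor F (hcomp X f g) = hcomp A (fhor F f) (fhor F g)"
    and fver_vcomp: "\<lbrakk>j \<in> Ver X; k \<in> Ver X; vcod X j = vdom X k\<rbrakk> \<Longrightarrow>
        fver F (vcomp X j k) = vcomp A (fver F j) (fver F k)"
    and fsqr_beside: "\<lbrakk>\<alpha> \<in> Sqr X; \<beta> \<in> Sqr X; sright X \<alpha> = sleft X \<beta>\<rbrakk> \<Longrightarrow>
        fsqr F (beside X \<alpha> \<beta>) = beside A (fsqr F \<alpha>) (fsqr F \<beta>)"
    and fsqr_above: "\<lbrakk>\<alpha> \<in> Sqr X; \<beta> \<in> Sqr X; sbot X \<alpha> = stop X \<beta>\<rbrakk> \<Longrightarrow>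
        fsqr F (above X \<alpha> \<beta>) = above A (fsqr F \<alpha>) (fsqr F \<beta>)"

definition dfun_id :: "('o, 'h, 'v, 's, 'o, 'h, 'v, 's) dfun" where
  "dfun_id = \<lparr>fob = id, fhor = id, fver = id, fsqr = id\<rparr>"

text \<open>\<open>dfun_comp F G\<close> is F followed by G.\<close>

definition dfun_comp ::
  "('o, 'h, 'v, 's, 'o2, 'h2, 'v2, 's2) dfun \<Rightarrow>
    ('o2, 'h2, 'v2, 's2, 'o3, 'h3, 'v3, 's3) dfun \<Rightarrow>
    ('o, 'h, 'v, 's, 'o3, 'h3, 'v3, 's3) dfun" where
  "dfun_comp F G = \<lparr>fob = fob G \<circ> fob F, fhor = fhor G \<circ> fhor F,
     fver = fver G \<circ> fver F, fsqr = fsqr G \<circ> fsqr F\<rparr>"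

record ('o, 'v, 'h2, 's2) htrans =
  tob :: "'o \<Rightarrow> 'h2"
  tver :: "'v \<Rightarrow> 's2"

locale horizontal_transformation = F: double_functor X A F + G: double_functor X A G
  for X :: "('o, 'h, 'v, 's) dcat" and A :: "('o2, 'h2, 'v2, 's2) dcat"
    and F G :: "('o, 'h, 'v, 's, 'o2, 'h2, 'v2, 's2) dfun" +
  fixes \<theta> :: "('o, 'v, 'h2, 's2) htrans"
  assumes tob: "C \<in> Obj X \<Longrightarrow> tob \<theta> C \<in> Hor A \<and>
        hdom A (tob \<theta> C) = fob F C \<and> hcod A (tob \<theta> C) = fob G C"
    and tver: "j \<in> Ver X \<Longrightarrow> tver \<theta> j \<in> Sqr A \<and>
        sleft A (tver \<theta> j) = fver F j \<and> sright A (tver \<theta> j) = fver G j \<and>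
        stop A (tver \<theta> j) = tob \<theta> (vdom X j) \<and> sbot A (tver \<theta> j) = tob \<theta> (vcod X j)"
    and tver_vid: "C \<in> Obj X \<Longrightarrow> tver \<theta> (vid X C) = iv A (tob \<theta> C)"
    and tver_vcomp: "\<lbrakk>j \<in> Ver X; k \<in> Ver X; vcod X j = vdom X k\<rbrakk> \<Longrightarrow>
        tver \<theta> (vcomp X j k) = above A (tver \<theta> j) (tver \<theta> k)"
    and naturality: "\<alpha> \<in> Sqr X \<Longrightarrow>
        beside A (fsqr F \<alpha>) (tver \<theta> (sright X \<alpha>)) = beside A (tver \<theta> (sleft X \<alpha>)) (fsqr G \<alpha>)"

text \<open>An adjunction, with F the left adjoint, in the 2-category of double categories, double
  functors and horizontal natural transformations. An equation between horizontal
  transformations consists of one equation per object and one per vertical morphism.\<close>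

locale horizontal_adjunction =
  F: double_functor X A F + G: double_functor A X G +
  unit: horizontal_transformation X X dfun_id "dfun_comp F G" \<eta> +
  counit: horizontal_transformation A A "dfun_comp G F" dfun_id \<epsilon>
  for X :: "('o, 'h, 'v, 's) dcat" and A :: "('o2, 'h2, 'v2, 's2) dcat"
    and F :: "('o, 'h, 'v, 's, 'o2, 'h2, 'v2, 's2) dfun"
    and G :: "('o2, 'h2, 'v2, 's2, 'o, 'h, 'v, 's) dfun"
    and \<eta> :: "('o, 'v, 'h, 's) htrans" and \<epsilon> :: "('o2, 'v2, 'h2, 's2) htrans" +
  assumes triangle_F_ob: "C \<in> Obj X \<Longrightarrow>
        hcomp A (fhor F (tob \<eta> C)) (tob \<epsilon> (fob F C)) = hid A (fob F C)"
    and triangle_F_ver: "j \<in> Ver X \<Longrightarrow>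
        beside A (fsqr F (tver \<eta> j)) (tver \<epsilon> (fver F j)) = ih A (fver F j)"
    and triangle_G_ob: "B \<in> Obj A \<Longrightarrow>
        hcomp X (tob \<eta> (fob G B)) (fhor G (tob \<epsilon> B)) = hid X (fob G B)"
    and triangle_G_ver: "k \<in> Ver A \<Longrightarrow>
        beside X (tver \<eta> (fver G k)) (fsqr G (tver \<epsilon> k)) = ih X (fver G k)"

definition has_horizontal_right_adjoint ::
  "('o, 'h, 'v, 's) dcat \<Rightarrow> ('o2, 'h2, 'v2, 's2) dcat \<Rightarrow>
    ('o, 'h, 'v, 's, 'o2, 'h2, 'v2, 's2) dfun \<Rightarrow> bool" where
  "has_horizontal_right_adjoint X A F \<longleftrightarrow> (\<exists>G \<eta> \<epsilon>. horizontal_adjunction X A F G \<eta> \<epsilon>)"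

datatype ('o, 'h, 's) monad =
  Monad (mob: 'o) (mhor: 'h) (mmult: 's) (munit: 's)

text \<open>Morphisms and squares between monads carry their boundary, since the underlying data
  in \<open>\<D>\<close> does not determine it.\<close>

datatype ('o, 'h, 's) mnd_hor =
  MHor (mh_dom: "('o, 'h, 's) monad") (mh_cod: "('o, 'h, 's) monad") (mh_hor: 'h) (mh_sqr: 's)

datatype ('o, 'h, 'v, 's) mnd_ver =
  MVer (mv_dom: "('o, 'h, 's) monad") (mv_cod: "('o, 'h, 's) monad") (mv_ver: 'v) (mv_sqr: 's)

datatype ('o, 'h, 'v, 's) mnd_sqr =
  MSqr (ms_left: "('o, 'h, 'v, 's) mnd_ver") (ms_right: "('o, 'h, 'v, 's) mnd_ver")
    (ms_top: "('o, 'h, 's) mnd_hor") (ms_bot: "('o, 'h, 's) mnd_hor") (ms_sqr: 's)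

definition square_with :: "('o, 'h, 'v, 's) dcat \<Rightarrow> 's \<Rightarrow> 'v \<Rightarrow> 'v \<Rightarrow> 'h \<Rightarrow> 'h \<Rightarrow> bool" where
  "square_with D \<alpha> l r t b \<longleftrightarrow>
     \<alpha> \<in> Sqr D \<and> sleft D \<alpha> = l \<and> sright D \<alpha> = r \<and> stop D \<alpha> = t \<and> sbot D \<alpha> = b"

fun is_monad :: "('o, 'h, 'v, 's) dcat \<Rightarrow> ('o, 'h, 's) monad \<Rightarrow> bool" where
  "is_monad D (Monad X S \<mu> \<eta>) \<longleftrightarrow>
     X \<in> Obj D \<and> S \<in> Hor D \<and> hdom D S = X \<and> hcod D S = X \<and>
     square_with D \<mu> (vid D X) (vid D X) (hcomp D S S) S \<and>
     square_with D \<eta> (vid D X) (vid D X) (hid D X) S \<and>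
     above D (beside D \<mu> (iv D S)) \<mu> = above D (beside D (iv D S) \<mu>) \<mu> \<and>
     above D (beside D \<eta> (iv D S)) \<mu> = iv D S \<and>
     above D (beside D (iv D S) \<eta>) \<mu> = iv D S"

fun is_mnd_hor :: "('o, 'h, 'v, 's) dcat \<Rightarrow> ('o, 'h, 's) mnd_hor \<Rightarrow> bool" where
  "is_mnd_hor D (MHor (Monad X P \<mu>P \<eta>P) (Monad Y Q \<mu>Q \<eta>Q) F \<phi>) \<longleftrightarrow>
     is_monad D (Monad X P \<mu>P \<eta>P) \<and> is_monad D (Monad Y Q \<mu>Q \<eta>Q) \<and>
     F \<in> Hor D \<and> hdom D F = X \<and> hcod D F = Y \<and>
     square_with D \<phi> (vid D X) (vid D Y) (hcomp D F Q) (hcomp D P F) \<and>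
     above D (beside D (iv D F) \<eta>Q) \<phi> = beside D \<eta>P (iv D F) \<and>
     above D (beside D (iv D F) \<mu>Q) \<phi> =
       above D (above D (beside D \<phi> (iv D Q)) (beside D (iv D P) \<phi>)) (beside D \<mu>P (iv D F))"

fun is_mnd_ver :: "('o, 'h, 'v, 's) dcat \<Rightarrow> ('o, 'h, 'v, 's) mnd_ver \<Rightarrow> bool" where
  "is_mnd_ver D (MVer (Monad X P \<mu>P \<eta>P) (Monad X' P' \<mu>P' \<eta>P') u \<upsilon>) \<longleftrightarrow>
     is_monad D (Monad X P \<mu>P \<eta>P) \<and> is_monad D (Monad X' P' \<mu>P' \<eta>P') \<and>
     u \<in> Ver D \<and> vdom D u = X \<and> vcod D u = X' \<and>
     square_with D \<upsilon> u u P P' \<and>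
     above D \<eta>P \<upsilon> = above D (ih D u) \<eta>P' \<and>
     above D \<mu>P \<upsilon> = above D (beside D \<upsilon> \<upsilon>) \<mu>P'"

fun is_mnd_sqr :: "('o, 'h, 'v, 's) dcat \<Rightarrow> ('o, 'h, 'v, 's) mnd_sqr \<Rightarrow> bool" where
  "is_mnd_sqr D (MSqr l r t b \<alpha>) \<longleftrightarrow>
     is_mnd_ver D l \<and> is_mnd_ver D r \<and> is_mnd_hor D t \<and> is_mnd_hor D b \<and>
     mv_dom l = mh_dom t \<and> mv_cod l = mh_dom b \<and>
     mv_dom r = mh_cod t \<and> mv_cod r = mh_cod b \<and>
     square_with D \<alpha> (mv_ver l) (mv_ver r) (mh_hor t) (mh_hor b) \<and>
     above D (mh_sqr t) (beside D (mv_sqr l) \<alpha>) = above D (beside D \<alpha> (mv_sqr r)) (mh_sqr b)"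

fun mnd_hcomp :: "('o, 'h, 'v, 's) dcat \<Rightarrow>
    ('o, 'h, 's) mnd_hor \<Rightarrow> ('o, 'h, 's) mnd_hor \<Rightarrow> ('o, 'h, 's) mnd_hor" where
  "mnd_hcomp D (MHor M N F \<phi>) (MHor N' R G \<psi>) =
     MHor M R (hcomp D F G) (above D (beside D (iv D F) \<psi>) (beside D \<phi> (iv D G)))"

fun mnd_vcomp :: "('o, 'h, 'v, 's) dcat \<Rightarrow>
    ('o, 'h, 'v, 's) mnd_ver \<Rightarrow> ('o, 'h, 'v, 's) mnd_ver \<Rightarrow> ('o, 'h, 'v, 's) mnd_ver" where
  "mnd_vcomp D (MVer M N u \<upsilon>) (MVer N' R w \<omega>) = MVer M R (vcomp D u w) (above D \<upsilon> \<omega>)"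

definition mnd_hid :: "('o, 'h, 'v, 's) dcat \<Rightarrow> ('o, 'h, 's) monad \<Rightarrow> ('o, 'h, 's) mnd_hor" where
  "mnd_hid D M = MHor M M (hid D (mob M)) (iv D (mhor M))"

definition mnd_vid :: "('o, 'h, 'v, 's) dcat \<Rightarrow> ('o, 'h, 's) monad \<Rightarrow> ('o, 'h, 'v, 's) mnd_ver" where
  "mnd_vid D M = MVer M M (vid D (mob M)) (iv D (mhor M))"

definition Mnd :: "('o, 'h, 'v, 's) dcat \<Rightarrow>
    (('o, 'h, 's) monad, ('o, 'h, 's) mnd_hor,
     ('o, 'h, 'v, 's) mnd_ver, ('o, 'h, 'v, 's) mnd_sqr) dcat" where
  "Mnd D = \<lparr>Obj = {M. is_monad D M}, Hor = {f. is_mnd_hor D f}, Ver = {j. is_mnd_ver D j},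
     Sqr = {\<alpha>. is_mnd_sqr D \<alpha>},
     hdom = mh_dom, hcod = mh_cod, vdom = mv_dom, vcod = mv_cod,
     sleft = ms_left, sright = ms_right, stop = ms_top, sbot = ms_bot,
     hid = mnd_hid D, vid = mnd_vid D,
     ih = (\<lambda>j. MSqr j j (mnd_hid D (mv_dom j)) (mnd_hid D (mv_cod j)) (ih D (mv_ver j))),
     iv = (\<lambda>f. MSqr (mnd_vid D (mh_dom f)) (mnd_vid D (mh_cod f)) f f (iv D (mh_hor f))),
     hcomp = mnd_hcomp D, vcomp = mnd_vcomp D,
     beside = (\<lambda>\<alpha> \<beta>. MSqr (ms_left \<alpha>) (ms_right \<beta>)
       (mnd_hcomp D (ms_top \<alpha>) (ms_top \<beta>)) (mnd_hcomp D (ms_bot \<alpha>) (ms_bot \<beta>))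
       (beside D (ms_sqr \<alpha>) (ms_sqr \<beta>))),
     above = (\<lambda>\<alpha> \<beta>. MSqr (mnd_vcomp D (ms_left \<alpha>) (ms_left \<beta>))
       (mnd_vcomp D (ms_right \<alpha>) (ms_right \<beta>)) (ms_top \<alpha>) (ms_bot \<beta>)
       (above D (ms_sqr \<alpha>) (ms_sqr \<beta>)))\<rparr>"

definition id_monad :: "('o, 'h, 'v, 's) dcat \<Rightarrow> 'o \<Rightarrow> ('o, 'h, 's) monad" where
  "id_monad D I = Monad I (hid D I) (iv D (hid D I)) (iv D (hid D I))"

definition inc_hor :: "('o, 'h, 'v, 's) dcat \<Rightarrow> 'h \<Rightarrow> ('o, 'h, 's) mnd_hor" where
  "inc_hor D f = MHor (id_monad D (hdom D f)) (id_monad D (hcod D f)) f (iv D f)"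

definition inc_ver :: "('o, 'h, 'v, 's) dcat \<Rightarrow> 'v \<Rightarrow> ('o, 'h, 'v, 's) mnd_ver" where
  "inc_ver D u = MVer (id_monad D (vdom D u)) (id_monad D (vcod D u)) u (ih D u)"

definition Inc :: "('o, 'h, 'v, 's) dcat \<Rightarrow>
    ('o, 'h, 'v, 's, ('o, 'h, 's) monad, ('o, 'h, 's) mnd_hor,
     ('o, 'h, 'v, 's) mnd_ver, ('o, 'h, 'v, 's) mnd_sqr) dfun" where
  "Inc D = \<lparr>fob = id_monad D, fhor = inc_hor D, fver = inc_ver D,
     fsqr = (\<lambda>\<alpha>. MSqr (inc_ver D (sleft D \<alpha>)) (inc_ver D (sright D \<alpha>))
       (inc_hor D (stop D \<alpha>)) (inc_hor D (sbot D \<alpha>)) \<alpha>)\<rparr>"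

text \<open>A vertically lax double functor from a double category \<open>P\<close> to \<open>\<S>pan\<^sup>t\<close>, written out.
  The sets on objects are subsets of a type \<open>'a\<close> and the apexes of the spans subsets of a
  type \<open>'b\<close>; the functions involved matter only on these subsets. \<open>pcomp K j k x y\<close> is the
  value of the comparison map at the point (x, y) of the pullback of \<open>K(j)\<close> and \<open>K(k)\<close>.
  A presheaf on \<open>\<D>\<close> parameterized by \<open>\<E>\<close> is the case \<open>P = dprod (horop \<D>) \<E>\<close>.\<close>

record ('o, 'h, 'v, 's, 'a, 'b) psh =
  pob :: "'o \<Rightarrow> 'a set"
  phor :: "'h \<Rightarrow> 'a \<Rightarrow> 'a"
  pver :: "'v \<Rightarrow> 'b set"
  ptop :: "'v \<Rightarrow> 'b \<Rightarrow> 'a"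
  pbot :: "'v \<Rightarrow> 'b \<Rightarrow> 'a"
  psqr :: "'s \<Rightarrow> 'b \<Rightarrow> 'b"
  pcomp :: "'v \<Rightarrow> 'v \<Rightarrow> 'b \<Rightarrow> 'b \<Rightarrow> 'b"
  punit :: "'o \<Rightarrow> 'a \<Rightarrow> 'b"

locale lax_span_functor = P: double_category P
  for P :: "('o, 'h, 'v, 's) dcat" +
  fixes K :: "('o, 'h, 'v, 's, 'a, 'b) psh"
  assumes phor: "\<lbrakk>f \<in> Hor P; x \<in> pob K (hdom P f)\<rbrakk> \<Longrightarrow> phor K f x \<in> pob K (hcod P f)"
    and phor_hid: "\<lbrakk>C \<in> Obj P; x \<in> pob K C\<rbrakk> \<Longrightarrow> phor K (hid P C) x = x"
    and phor_hcomp: "\<lbrakk>f \<in> Hor P; g \<in> Hor P; hcod P f = hdom P g; x \<in> pob K (hdom P f)\<rbrakk> \<Longrightarrow>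
        phor K (hcomp P f g) x = phor K g (phor K f x)"
    and legs: "\<lbrakk>j \<in> Ver P; p \<in> pver K j\<rbrakk> \<Longrightarrow>
        ptop K j p \<in> pob K (vdom P j) \<and> pbot K j p \<in> pob K (vcod P j)"
    and psqr: "\<lbrakk>\<alpha> \<in> Sqr P; p \<in> pver K (sleft P \<alpha>)\<rbrakk> \<Longrightarrow>
        psqr K \<alpha> p \<in> pver K (sright P \<alpha>) \<and>
        ptop K (sright P \<alpha>) (psqr K \<alpha> p) = phor K (stop P \<alpha>) (ptop K (sleft P \<alpha>) p) \<and>
        pbot K (sright P \<alpha>) (psqr K \<alpha> p) = phor K (sbot P \<alpha>) (pbot K (sleft P \<alpha>) p)"
    and psqr_ih: "\<lbrakk>j \<in> Ver P; p \<in> pver K j\<rbrakk> \<Longrightarrow> psqr K (ih P j) p = p"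
    and psqr_beside: "\<lbrakk>\<alpha> \<in> Sqr P; \<beta> \<in> Sqr P; sright P \<alpha> = sleft P \<beta>; p \<in> pver K (sleft P \<alpha>)\<rbrakk> \<Longrightarrow>
        psqr K (beside P \<alpha> \<beta>) p = psqr K \<beta> (psqr K \<alpha> p)"
    and pcomp: "\<lbrakk>j \<in> Ver P; k \<in> Ver P; vcod P j = vdom P k; p \<in> pver K j; q \<in> pver K k;
          pbot K j p = ptop K k q\<rbrakk> \<Longrightarrow>
        pcomp K j k p q \<in> pver K (vcomp P j k) \<and>
        ptop K (vcomp P j k) (pcomp K j k p q) = ptop K j p \<and>
        pbot K (vcomp P j k) (pcomp K j k p q) = pbot K k q"
    and punit: "\<lbrakk>C \<in> Obj P; x \<in> pob K C\<rbrakk> \<Longrightarrow>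
        punit K C x \<in> pver K (vid P C) \<and>
        ptop K (vid P C) (punit K C x) = x \<and> pbot K (vid P C) (punit K C x) = x"
    and pcomp_natural: "\<lbrakk>\<alpha> \<in> Sqr P; \<beta> \<in> Sqr P; sbot P \<alpha> = stop P \<beta>;
          p \<in> pver K (sleft P \<alpha>); q \<in> pver K (sleft P \<beta>);
          pbot K (sleft P \<alpha>) p = ptop K (sleft P \<beta>) q\<rbrakk> \<Longrightarrow>
        psqr K (above P \<alpha> \<beta>) (pcomp K (sleft P \<alpha>) (sleft P \<beta>) p q) =
        pcomp K (sright P \<alpha>) (sright P \<beta>) (psqr K \<alpha> p) (psqr K \<beta> q)"
    and punit_natural: "\<lbrakk>f \<in> Hor P; x \<in> pob K (hdom P f)\<rbrakk> \<Longrightarrow>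
        psqr K (iv P f) (punit K (hdom P f) x) = punit K (hcod P f) (phor K f x)"
    and pcomp_assoc: "\<lbrakk>i \<in> Ver P; j \<in> Ver P; k \<in> Ver P; vcod P i = vdom P j; vcod P j = vdom P k;
          p \<in> pver K i; q \<in> pver K j; r \<in> pver K k;
          pbot K i p = ptop K j q; pbot K j q = ptop K k r\<rbrakk> \<Longrightarrow>
        pcomp K (vcomp P i j) k (pcomp K i j p q) r = pcomp K i (vcomp P j k) p (pcomp K j k q r)"
    and pcomp_unit_left: "\<lbrakk>j \<in> Ver P; p \<in> pver K j\<rbrakk> \<Longrightarrow>
        pcomp K (vid P (vdom P j)) j (punit K (vdom P j) (ptop K j p)) p = p"
    and pcomp_unit_right: "\<lbrakk>j \<in> Ver P; p \<in> pver K j\<rbrakk> \<Longrightarrow>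
        pcomp K j (vid P (vcod P j)) p (punit K (vcod P j) (pbot K j p)) = p"

record ('o, 'v, 'a, 'b, 'a2, 'b2) psh_map =
  mapob :: "'o \<Rightarrow> 'a \<Rightarrow> 'a2"
  mapver :: "'v \<Rightarrow> 'b \<Rightarrow> 'b2"

locale psh_morphism = K: lax_span_functor P K + L: lax_span_functor P L
  for P :: "('o, 'h, 'v, 's) dcat"
    and K :: "('o, 'h, 'v, 's, 'a, 'b) psh" and L :: "('o, 'h, 'v, 's, 'a2, 'b2) psh" +
  fixes \<tau> :: "('o, 'v, 'a, 'b, 'a2, 'b2) psh_map"
  assumes mapob: "\<lbrakk>C \<in> Obj P; x \<in> pob K C\<rbrakk> \<Longrightarrow> mapob \<tau> C x \<in> pob L C"
    and mapver: "\<lbrakk>j \<in> Ver P; p \<in> pver K j\<rbrakk> \<Longrightarrow>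
        mapver \<tau> j p \<in> pver L j \<and>
        ptop L j (mapver \<tau> j p) = mapob \<tau> (vdom P j) (ptop K j p) \<and>
        pbot L j (mapver \<tau> j p) = mapob \<tau> (vcod P j) (pbot K j p)"
    and natural_hor: "\<lbrakk>f \<in> Hor P; x \<in> pob K (hdom P f)\<rbrakk> \<Longrightarrow>
        mapob \<tau> (hcod P f) (phor K f x) = phor L f (mapob \<tau> (hdom P f) x)"
    and natural_sqr: "\<lbrakk>\<alpha> \<in> Sqr P; p \<in> pver K (sleft P \<alpha>)\<rbrakk> \<Longrightarrow>
        mapver \<tau> (sright P \<alpha>) (psqr K \<alpha> p) = psqr L \<alpha> (mapver \<tau> (sleft P \<alpha>) p)"
    and map_pcomp: "\<lbrakk>j \<in> Ver P; k \<in> Ver P; vcod P j = vdom P k; p \<in> pver K j; q \<in> pver K k;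
          pbot K j p = ptop K k q\<rbrakk> \<Longrightarrow>
        mapver \<tau> (vcomp P j k) (pcomp K j k p q) = pcomp L j k (mapver \<tau> j p) (mapver \<tau> k q)"
    and map_punit: "\<lbrakk>C \<in> Obj P; x \<in> pob K C\<rbrakk> \<Longrightarrow>
        mapver \<tau> (vid P C) (punit K C x) = punit L C (mapob \<tau> C x)"

definition psh_isomorphic :: "('o, 'h, 'v, 's) dcat \<Rightarrow>
    ('o, 'h, 'v, 's, 'a, 'b) psh \<Rightarrow> ('o, 'h, 'v, 's, 'a2, 'b2) psh \<Rightarrow> bool" where
  "psh_isomorphic P K L \<longleftrightarrow> (\<exists>\<sigma> \<tau>. psh_morphism P K L \<sigma> \<and> psh_morphism P L K \<tau> \<and>
     (\<forall>C\<in>Obj P. (\<forall>x\<in>pob K C. mapob \<tau> C (mapob \<sigma> C x) = x) \<and>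
                (\<forall>y\<in>pob L C. mapob \<sigma> C (mapob \<tau> C y) = y)) \<and>
     (\<forall>j\<in>Ver P. (\<forall>x\<in>pver K j. mapver \<tau> j (mapver \<sigma> j x) = x) \<and>
                (\<forall>y\<in>pver L j. mapver \<sigma> j (mapver \<tau> j y) = y)))"

text \<open>For \<open>F: \<X> \<rightarrow> \<A>\<close> and \<open>G: \<E> \<rightarrow> \<A>\<close>, the presheaf \<open>\<A>(F-,G-)\<close> on \<open>dprod (horop \<X>) \<E>\<close>.
  The presheaf \<open>\<A>(F-,-)\<close> on \<open>dprod (horop \<X>) (V1 \<A>)\<close> is the case \<open>G = dfun_id\<close>, read as the
  inclusion of \<open>V1 \<A>\<close>; the presheaf \<open>\<A>(-,G-)\<close> on \<open>dprod (horop \<A>) \<E>\<close> is the case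
  \<open>F = dfun_id\<close>.\<close>

definition hom_psh :: "('o2, 'h2, 'v2, 's2) dcat \<Rightarrow>
    ('o, 'h, 'v, 's, 'o2, 'h2, 'v2, 's2) dfun \<Rightarrow>
    ('o3, 'h3, 'v3, 's3, 'o2, 'h2, 'v2, 's2) dfun \<Rightarrow>
    ('o \<times> 'o3, 'h \<times> 'h3, 'v \<times> 'v3, 's \<times> 's3, 'h2, 's2) psh" where
  "hom_psh A F G = \<lparr>
     pob = (\<lambda>(X, E). {f \<in> Hor A. hdom A f = fob F X \<and> hcod A f = fob G E}),
     phor = (\<lambda>(g, e) f. hcomp A (hcomp A (fhor F g) f) (fhor G e)),
     pver = (\<lambda>(j, k). {\<alpha> \<in> Sqr A. sleft A \<alpha> = fver F j \<and> sright A \<alpha> = fver G k}),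
     ptop = (\<lambda>_. stop A),
     pbot = (\<lambda>_. sbot A),
     psqr = (\<lambda>(\<beta>, \<gamma>) \<alpha>. beside A (beside A (fsqr F \<beta>) \<alpha>) (fsqr G \<gamma>)),
     pcomp = (\<lambda>_ _. above A),
     punit = (\<lambda>_. iv A)\<rparr>"

definition Alg :: "('o, 'h, 'v, 's) dcat \<Rightarrow>
    ('o \<times> ('o, 'h, 's) monad, 'h \<times> ('o, 'h, 's) mnd_hor,
     'v \<times> ('o, 'h, 'v, 's) mnd_ver, 's \<times> ('o, 'h, 'v, 's) mnd_sqr,
     ('o, 'h, 's) mnd_hor, ('o, 'h, 'v, 's) mnd_sqr) psh" where
  "Alg D = hom_psh (Mnd D) (Inc D) dfun_id"

definition representable :: "('o, 'h, 'v, 's) dcat \<Rightarrow> ('o2, 'h2, 'v2, 's2) dcat \<Rightarrow>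
    ('o \<times> 'o2, 'h \<times> 'h2, 'v \<times> 'v2, 's \<times> 's2, 'a, 'b) psh \<Rightarrow> bool" where
  "representable D E K \<longleftrightarrow> (\<exists>G. double_functor E D G \<and>
     psh_isomorphic (dprod (horop D) E) K (hom_psh D dfun_id G))"

end

theory Submission
  imports Defs
begin

text \<open>
  A horizontal double adjoint can be tested on \<open>\<V>\<^sub>1\<A>\<close>: for any double functor
  \<open>F: \<X> \<rightarrow> \<A>\<close>, a right adjoint amounts to a representation of \<open>\<A>(F-,-)\<close> on
  \<open>\<X>\<^bsup>horop\<^esup> \<times> \<V>\<^sub>1\<A>\<close>. From an adjunction the representation is transposition
  \<open>\<alpha> \<mapsto> [\<eta> G\<alpha>]\<close>. Conversely, a representing \<open>G\<close> is only given on objects and vertical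
  morphisms, but the images \<open>\<epsilon>\<close> of the identities satisfy \<open>\<tau>(\<beta>) = [F\<beta> \<epsilon>]\<close> by naturality,
  so bijectivity of \<open>\<tau>\<close> is a universal property of \<open>\<epsilon>\<close>, by which \<open>G\<close> extends uniquely to
  horizontal morphisms and squares so as to make \<open>\<epsilon>\<close> natural; functoriality, the unit and the
  triangle identities follow from uniqueness. The theorem is the case of \<open>Inc D\<close>, once monads
  are known to form a double category, which is a pasting computation.
\<close>

section \<open>Double categories\<close>

context cat_structure
begin

lemma dom_cod_in [simp]: "f \<in> Ar \<Longrightarrow> dom f \<in> Ob" "f \<in> Ar \<Longrightarrow> cod f \<in> Ob"
  using dom_cod by auto

lemma idt_simps [simp]:
  "A \<in> Ob \<Longrightarrow> idt A \<in> Ar" "A \<in> Ob \<Longrightarrow> dom (idt A) = A" "A \<in> Ob \<Longrightarrow> cod (idt A) = A"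
  using idt by auto

lemma cmp_simps [simp]:
  assumes "f \<in> Ar" "g \<in> Ar" "cod f = dom g"
  shows "cmp f g \<in> Ar" "dom (cmp f g) = dom f" "cod (cmp f g) = cod g"
  using cmp[OF assms] by auto

lemma idt_cmp_simp [simp]: "f \<in> Ar \<Longrightarrow> dom f = A \<Longrightarrow> cmp (idt A) f = f"
  using idt_cmp by auto

lemma cmp_idt_simp [simp]: "f \<in> Ar \<Longrightarrow> cod f = A \<Longrightarrow> cmp f (idt A) = f"
  using cmp_idt by auto

end

context double_category
begin

sublocale H: cat_structure "Obj D" "Hor D" "hdom D" "hcod D" "hid D" "hcomp D"
  by (rule hor_cat)
sublocale V: cat_structure "Obj D" "Ver D" "vdom D" "vcod D" "vid D" "vcomp D"
  by (rule ver_cat)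
sublocale SH: cat_structure "Ver D" "Sqr D" "sleft D" "sright D" "ih D" "beside D"
  by (rule sqr_hcat)
sublocale SV: cat_structure "Hor D" "Sqr D" "stop D" "sbot D" "iv D" "above D"
  by (rule sqr_vcat)

text \<open>As rewrite rules the corner equations go from horizontal to vertical boundaries: for most
  squares below only the sides are known explicitly.\<close>

lemma corner_simps [simp]:
  assumes "\<alpha> \<in> Sqr D"
  shows "hdom D (stop D \<alpha>) = vdom D (sleft D \<alpha>)" "hdom D (sbot D \<alpha>) = vcod D (sleft D \<alpha>)"
    "hcod D (stop D \<alpha>) = vdom D (sright D \<alpha>)" "hcod D (sbot D \<alpha>) = vcod D (sright D \<alpha>)"
  using corners[OF assms] by auto

text \<open>Both equations come from taking domains and codomains of the shared boundary
  \<open>sbot D \<alpha> = stop D \<beta>\<close>. \<open>corner_simps\<close> rewrites away from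
  that boundary, so they are supplied separately.\<close>

lemma sides_composable:
  assumes "\<alpha> \<in> Sqr D" "\<beta> \<in> Sqr D" "sbot D \<alpha> = stop D \<beta>"
  shows "vcod D (sleft D \<alpha>) = vdom D (sleft D \<beta>)" "vcod D (sright D \<alpha>) = vdom D (sright D \<beta>)"
  using corners[OF assms(1)] corners[OF assms(2)] assms(3) by auto

lemma ends_composable:
  assumes "\<alpha> \<in> Sqr D" "\<beta> \<in> Sqr D" "sright D \<alpha> = sleft D \<beta>"
  shows "hcod D (stop D \<alpha>) = hdom D (stop D \<beta>)" "hcod D (sbot D \<alpha>) = hdom D (sbot D \<beta>)"
  using corners[OF assms(1)] corners[OF assms(2)] assms(3) by auto

declare ih_boundary [simp] iv_boundary [simp] beside_boundary [simp] above_boundary [simp]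

lemma ih_vid_simp [simp]: "A \<in> Obj D \<Longrightarrow> ih D (vid D A) = iv D (hid D A)"
  by (rule ih_vid)

lemma V1_simps:
  "Obj (V1 D) = Obj D" "Hor (V1 D) = hid D ` Obj D" "Ver (V1 D) = Ver D" "Sqr (V1 D) = ih D ` Ver D"
  "hdom (V1 D) = hdom D" "hcod (V1 D) = hcod D" "vdom (V1 D) = vdom D" "vcod (V1 D) = vcod D"
  "sleft (V1 D) = sleft D" "sright (V1 D) = sright D" "stop (V1 D) = stop D" "sbot (V1 D) = sbot D"
  "hid (V1 D) = hid D" "vid (V1 D) = vid D" "ih (V1 D) = ih D" "iv (V1 D) = iv D"
  "hcomp (V1 D) = hcomp D" "vcomp (V1 D) = vcomp D" "beside (V1 D) = beside D" "above (V1 D) = above D"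
  by (simp_all add: V1_def)

text \<open>Vertical composability of \<open>ih D j\<close> and \<open>ih D k\<close> is an equation
  between identity morphisms; injectivity turns it into composability of \<open>j\<close> and
  \<open>k\<close>, which keeps \<open>V1 D\<close> closed under \<open>above D\<close>.\<close>

lemma hid_eq_iff: "A \<in> Obj D \<Longrightarrow> B \<in> Obj D \<Longrightarrow> hid D A = hid D B \<longleftrightarrow> A = B"
  by (metis H.idt_simps(2))

lemma above_ih [simp]: "j \<in> Ver D \<Longrightarrow> k \<in> Ver D \<Longrightarrow> vcod D j = vdom D k \<Longrightarrow>
    above D (ih D j) (ih D k) = ih D (vcomp D j k)"
  by (simp add: ih_vcomp)

lemma beside_iv [simp]: "f \<in> Hor D \<Longrightarrow> g \<in> Hor D \<Longrightarrow> hcod D f = hdom D g \<Longrightarrow>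
    beside D (iv D f) (iv D g) = iv D (hcomp D f g)"
  by (simp add: iv_hcomp)

text \<open>This square is \<open>ih D (vid D A)\<close>, so \<open>V1 D\<close> contains the
  identities for vertical composition of its squares.\<close>

lemma iv_hid_in_ih: "A \<in> Obj D \<Longrightarrow> iv D (hid D A) \<in> ih D ` Ver D"
  by (metis H.idt_simps(1) V.idt_simps(1) ih_vid_simp imageI)

lemma double_category_V1: "double_category (V1 D)"
  by unfold_locales
    (auto simp: V1_simps hid_eq_iff iv_hid_in_ih interchange H.cmp_assoc V.cmp_assoc SH.cmp_assoc SV.cmp_assoc)

lemma double_category_horop: "double_category (horop D)"
  by unfold_locales
    (simp_all add: horop_def interchange H.cmp_assoc V.cmp_assoc SH.cmp_assoc SV.cmp_assoc)

end

lemma double_category_dprod: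
  assumes "double_category D" "double_category E"
  shows "double_category (dprod D E)"
proof -
  interpret D: double_category D by fact
  interpret E: double_category E by fact
  show ?thesis
    by unfold_locales
     (auto simp: dprod_def D.interchange D.H.cmp_assoc D.V.cmp_assoc
       D.SH.cmp_assoc D.SV.cmp_assoc E.interchange E.H.cmp_assoc E.V.cmp_assoc
       E.SH.cmp_assoc E.SV.cmp_assoc)
qed

section \<open>Double functors and hom presheaves\<close>

context double_functor
begin

declare fob [simp] fhor [simp] fver [simp] fsqr [simp] fhor_hid [simp] fver_vid [simp]
  fsqr_ih [simp] fsqr_iv [simp] fhor_hcomp [simp] fver_vcomp [simp] fsqr_beside [simp]
  fsqr_above [simp]

end

lemma dfun_id_simps [simp]:
  "fob dfun_id x = x" "fhor dfun_id f = f" "fver dfun_id j = j" "fsqr dfun_id \<alpha> = \<alpha>"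
  by (simp_all add: dfun_id_def)

lemma dfun_comp_simps [simp]:
  "fob (dfun_comp F G) x = fob G (fob F x)" "fhor (dfun_comp F G) f = fhor G (fhor F f)"
  "fver (dfun_comp F G) j = fver G (fver F j)" "fsqr (dfun_comp F G) \<alpha> = fsqr G (fsqr F \<alpha>)"
  by (simp_all add: dfun_comp_def)

lemma double_functor_id: "double_category A \<Longrightarrow> double_functor A A dfun_id"
  by (simp add: double_functor_def double_functor_axioms_def)

lemma double_functor_comp:
  assumes "double_functor X Y F" "double_functor Y Z G"
  shows "double_functor X Z (dfun_comp F G)"
proof -
  interpret F: double_functor X Y F by fact
  interpret G: double_functor Y Z G by fact
  show ?thesis by unfold_locales simp_all
qed

lemma double_functor_V1:
  assumes "double_functor A X G"
  shows "double_functor (V1 A) X G"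
proof -
  interpret G: double_functor A X G by fact
  interpret V: double_category "V1 A" by (rule G.X.double_category_V1)
  show ?thesis
    by unfold_locales (auto simp: G.X.V1_simps G.X.hid_eq_iff)
qed

text \<open>Naturality of the comparison \<open>above A\<close> is interchange, and that of
  \<open>iv A\<close> is its compatibility with horizontal composition. The other laws are category
  laws and boundary equations of \<open>A\<close>.\<close>

lemma lax_span_functor_hom_psh:
  assumes "double_functor X A F" "double_functor E A G"
  shows "lax_span_functor (dprod (horop X) E) (hom_psh A F G)"
proof -
  interpret F: double_functor X A F by fact
  interpret G: double_functor E A G by fact
  interpret P: double_category "dprod (horop X) E"
    by (rule double_category_dprod[OF F.X.double_category_horop G.X.double_category_axioms])
  show ?thesis
    by unfold_locales
      (clarsimp simp: dprod_def horop_def hom_psh_def F.A.H.cmp_assoc F.A.SH.cmp_assoc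
        F.A.SV.cmp_assoc F.A.interchange)+
qed

section \<open>Adjoints from universal counits\<close>

text \<open>A right adjoint presented by its action on objects and vertical morphisms together with a
  counit that is universal both for horizontal morphisms and for squares; the action of the
  right adjoint on horizontal morphisms and squares is then forced.\<close>

locale universal_counit = F: double_functor X A F
  for X :: "('o, 'h, 'v, 's) dcat" and A :: "('o2, 'h2, 'v2, 's2) dcat"
    and F :: "('o, 'h, 'v, 's, 'o2, 'h2, 'v2, 's2) dfun" +
  fixes gob :: "'o2 \<Rightarrow> 'o" and gver :: "'v2 \<Rightarrow> 'v"
    and e :: "'o2 \<Rightarrow> 'h2" and es :: "'v2 \<Rightarrow> 's2"
  assumes gob [simp]: "B \<in> Obj A \<Longrightarrow> gob B \<in> Obj X"
    and gver [simp]: "k \<in> Ver A \<Longrightarrow> gver k \<in> Ver X \<and>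
        vdom X (gver k) = gob (vdom A k) \<and> vcod X (gver k) = gob (vcod A k)"
    and gver_vid [simp]: "B \<in> Obj A \<Longrightarrow> gver (vid A B) = vid X (gob B)"
    and gver_vcomp [simp]: "\<lbrakk>k \<in> Ver A; k' \<in> Ver A; vcod A k = vdom A k'\<rbrakk> \<Longrightarrow>
        gver (vcomp A k k') = vcomp X (gver k) (gver k')"
    and e [simp]: "B \<in> Obj A \<Longrightarrow> e B \<in> Hor A \<and> hdom A (e B) = fob F (gob B) \<and> hcod A (e B) = B"
    and es [simp]: "k \<in> Ver A \<Longrightarrow> es k \<in> Sqr A \<and> sleft A (es k) = fver F (gver k) \<and>
        sright A (es k) = k \<and> stop A (es k) = e (vdom A k) \<and> sbot A (es k) = e (vcod A k)"
    and es_vid [simp]: "B \<in> Obj A \<Longrightarrow> es (vid A B) = iv A (e B)"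
    and es_vcomp [simp]: "\<lbrakk>k \<in> Ver A; k' \<in> Ver A; vcod A k = vdom A k'\<rbrakk> \<Longrightarrow>
        es (vcomp A k k') = above A (es k) (es k')"
    and hor_ex: "\<lbrakk>f \<in> Hor A; C \<in> Obj X; hdom A f = fob F C\<rbrakk> \<Longrightarrow>
        \<exists>g\<in>Hor X. hdom X g = C \<and> hcod X g = gob (hcod A f) \<and>
          hcomp A (fhor F g) (e (hcod A f)) = f"
    and sqr_ex: "\<lbrakk>\<alpha> \<in> Sqr A; j \<in> Ver X; sleft A \<alpha> = fver F j\<rbrakk> \<Longrightarrow>
        \<exists>\<beta>\<in>Sqr X. sleft X \<beta> = j \<and> sright X \<beta> = gver (sright A \<alpha>) \<and>
          beside A (fsqr F \<beta>) (es (sright A \<alpha>)) = \<alpha>"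
    and hor_uniq: "\<lbrakk>B \<in> Obj A; g \<in> Hor X; g' \<in> Hor X; hdom X g = hdom X g';
        hcod X g = gob B; hcod X g' = gob B;
        hcomp A (fhor F g) (e B) = hcomp A (fhor F g') (e B)\<rbrakk> \<Longrightarrow> g = g'"
    and sqr_uniq: "\<lbrakk>k \<in> Ver A; \<beta> \<in> Sqr X; \<beta>' \<in> Sqr X; sleft X \<beta> = sleft X \<beta>';
        sright X \<beta> = gver k; sright X \<beta>' = gver k;
        beside A (fsqr F \<beta>) (es k) = beside A (fsqr F \<beta>') (es k)\<rbrakk> \<Longrightarrow> \<beta> = \<beta>'"
begin

text \<open>The transpose of \<open>f\<close> across \<open>e\<close>, unique by
  \<open>hor_uniq\<close>. The object \<open>C\<close> is an argument because \<open>fob F C\<close>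
  need not determine it.\<close>

definition lift_hor :: "'o \<Rightarrow> 'h2 \<Rightarrow> 'h" where
  "lift_hor C f = (SOME g. g \<in> Hor X \<and> hdom X g = C \<and> hcod X g = gob (hcod A f) \<and>
     hcomp A (fhor F g) (e (hcod A f)) = f)"

definition lift_sqr :: "'v \<Rightarrow> 's2 \<Rightarrow> 's" where
  "lift_sqr j \<alpha> = (SOME \<beta>. \<beta> \<in> Sqr X \<and> sleft X \<beta> = j \<and> sright X \<beta> = gver (sright A \<alpha>) \<and>
     beside A (fsqr F \<beta>) (es (sright A \<alpha>)) = \<alpha>)"

lemma lift_hor [simp]:
  assumes "f \<in> Hor A" "C \<in> Obj X" "hdom A f = fob F C"
  shows "lift_hor C f \<in> Hor X" "hdom X (lift_hor C f) = C"
    "hcod X (lift_hor C f) = gob (hcod A f)"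
    "hcod A f = B \<Longrightarrow> hcomp A (fhor F (lift_hor C f)) (e B) = f"
  using someI_ex[OF hor_ex[OF assms, unfolded Bex_def]] unfolding lift_hor_def by blast+

lemma lift_sqr [simp]:
  assumes "\<alpha> \<in> Sqr A" "j \<in> Ver X" "sleft A \<alpha> = fver F j"
  shows "lift_sqr j \<alpha> \<in> Sqr X" "sleft X (lift_sqr j \<alpha>) = j"
    "sright X (lift_sqr j \<alpha>) = gver (sright A \<alpha>)"
    "sright A \<alpha> = k \<Longrightarrow> beside A (fsqr F (lift_sqr j \<alpha>)) (es k) = \<alpha>"
  using someI_ex[OF sqr_ex[OF assms, unfolded Bex_def]] unfolding lift_sqr_def by blast+

lemma lift_sqr_corners:
  assumes "\<alpha> \<in> Sqr A" "j \<in> Ver X" "sleft A \<alpha> = fver F j"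
  shows "hdom X (stop X (lift_sqr j \<alpha>)) = vdom X j" "hdom X (sbot X (lift_sqr j \<alpha>)) = vcod X j"
    "hcod X (stop X (lift_sqr j \<alpha>)) = gob (hcod A (stop A \<alpha>))"
    "hcod X (sbot X (lift_sqr j \<alpha>)) = gob (hcod A (sbot A \<alpha>))"
    "hdom A (stop A \<alpha>) = fob F (vdom X j)" "hdom A (sbot A \<alpha>) = fob F (vcod X j)"
proof -
  note c = F.X.corners[OF lift_sqr(1)[OF assms]]
  show "hdom X (stop X (lift_sqr j \<alpha>)) = vdom X j" "hdom X (sbot X (lift_sqr j \<alpha>)) = vcod X j"
    using c assms by auto
  show "hcod X (stop X (lift_sqr j \<alpha>)) = gob (hcod A (stop A \<alpha>))"
    "hcod X (sbot X (lift_sqr j \<alpha>)) = gob (hcod A (sbot A \<alpha>))"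
    using c assms by auto
  show "hdom A (stop A \<alpha>) = fob F (vdom X j)" "hdom A (sbot A \<alpha>) = fob F (vcod X j)"
    using F.A.corners[OF assms(1)] assms by auto
qed

text \<open>The universal property of \<open>es\<close> prescribes only the sides of a lift.
  Comparing tops and bottoms in the factorization of \<open>\<alpha>\<close> through
  \<open>es\<close> and applying \<open>hor_uniq\<close> identifies the other two edges.\<close>

lemma lift_sqr_boundary [simp]:
  assumes "\<alpha> \<in> Sqr A" "j \<in> Ver X" "sleft A \<alpha> = fver F j"
  shows "stop X (lift_sqr j \<alpha>) = lift_hor (vdom X j) (stop A \<alpha>)"
    "sbot X (lift_sqr j \<alpha>) = lift_hor (vcod X j) (sbot A \<alpha>)"
proof -
  let ?\<beta> = "lift_sqr j \<alpha>"
  note c = lift_sqr_corners[OF assms]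
  have k: "sright A (fsqr F ?\<beta>) = sleft A (es (sright A \<alpha>))"
    using assms by simp
  have s: "beside A (fsqr F ?\<beta>) (es (sright A \<alpha>)) = \<alpha>"
    using assms by simp
  \<comment> \<open>\<open>lift_sqr(4)\<close> would rewrite the left side of \<open>s\<close> back
    to \<open>\<alpha>\<close> and make the equation trivial before its top is computed.\<close>
  have "hcomp A (fhor F (stop X ?\<beta>)) (e (hcod A (stop A \<alpha>))) = stop A \<alpha>"
    using arg_cong[OF s, of "stop A"] assms k by (simp del: lift_sqr(4))
  then show "stop X ?\<beta> = lift_hor (vdom X j) (stop A \<alpha>)"
    using assms c by (intro hor_uniq[of "hcod A (stop A \<alpha>)"]) simp_all
  have "hcomp A (fhor F (sbot X ?\<beta>)) (e (hcod A (sbot A \<alpha>))) = sbot A \<alpha>"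
    using arg_cong[OF s, of "sbot A"] assms k by (simp del: lift_sqr(4))
  then show "sbot X ?\<beta> = lift_hor (vcod X j) (sbot A \<alpha>)"
    using assms c by (intro hor_uniq[of "hcod A (sbot A \<alpha>)"]) simp_all
qed

text \<open>On horizontal morphisms and squares the value is the transpose of the counit followed by
  the argument, so naturality of the counit is built in.\<close>

definition radj :: "('o2, 'h2, 'v2, 's2, 'o, 'h, 'v, 's) dfun" where
  "radj = \<lparr>fob = gob, fhor = (\<lambda>f. lift_hor (gob (hdom A f)) (hcomp A (e (hdom A f)) f)),
     fver = gver, fsqr = (\<lambda>\<alpha>. lift_sqr (gver (sleft A \<alpha>)) (beside A (es (sleft A \<alpha>)) \<alpha>))\<rparr>"

definition radj_unit :: "('o, 'v, 'h, 's) htrans" where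
  "radj_unit = \<lparr>tob = (\<lambda>C. lift_hor C (hid A (fob F C))),
     tver = (\<lambda>j. lift_sqr j (ih A (fver F j)))\<rparr>"

definition radj_counit :: "('o2, 'v2, 'h2, 's2) htrans" where
  "radj_counit = \<lparr>tob = e, tver = es\<rparr>"

lemma radj_ob [simp]: "fob radj = gob"
  and radj_ver [simp]: "fver radj = gver"
  and radj_counit_simps [simp]: "tob radj_counit = e" "tver radj_counit = es"
  by (simp_all add: radj_def radj_counit_def)

lemma radj_hor [simp]:
  assumes "f \<in> Hor A"
  shows "fhor radj f \<in> Hor X" "hdom X (fhor radj f) = gob (hdom A f)"
    "hcod X (fhor radj f) = gob (hcod A f)"
    "hcod A f = B \<Longrightarrow> hcomp A (fhor F (fhor radj f)) (e B) = hcomp A (e (hdom A f)) f"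
  using assms by (simp_all add: radj_def)

lemma radj_sqr [simp]:
  assumes "\<alpha> \<in> Sqr A"
  shows "fsqr radj \<alpha> \<in> Sqr X" "sleft X (fsqr radj \<alpha>) = gver (sleft A \<alpha>)"
    "sright X (fsqr radj \<alpha>) = gver (sright A \<alpha>)"
    "stop X (fsqr radj \<alpha>) = fhor radj (stop A \<alpha>)"
    "sbot X (fsqr radj \<alpha>) = fhor radj (sbot A \<alpha>)"
    "sright A \<alpha> = k \<Longrightarrow> beside A (fsqr F (fsqr radj \<alpha>)) (es k) = beside A (es (sleft A \<alpha>)) \<alpha>"
  using assms by (simp_all add: radj_def)

text \<open>The last clause, the defining property of the lift of an identity, is the triangle
  identity at \<open>F\<close> on objects.\<close>

lemma radj_unit_hor [simp]:
  assumes "C \<in> Obj X"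
  shows "tob radj_unit C \<in> Hor X" "hdom X (tob radj_unit C) = C"
    "hcod X (tob radj_unit C) = gob (fob F C)"
    "hcomp A (fhor F (tob radj_unit C)) (e (fob F C)) = hid A (fob F C)"
  using assms by (simp_all add: radj_unit_def)

lemma radj_unit_sqr [simp]:
  assumes "j \<in> Ver X"
  shows "tver radj_unit j \<in> Sqr X" "sleft X (tver radj_unit j) = j"
    "sright X (tver radj_unit j) = gver (fver F j)"
    "stop X (tver radj_unit j) = tob radj_unit (vdom X j)"
    "sbot X (tver radj_unit j) = tob radj_unit (vcod X j)"
    "beside A (fsqr F (tver radj_unit j)) (es (fver F j)) = ih A (fver F j)"
  using assms by (simp_all add: radj_unit_def)

text \<open>By \<open>hor_uniq\<close> and \<open>sqr_uniq\<close>, an equation between lifts can be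
  checked after composing with the counit; there \<open>radj_hor(4)\<close> and
  \<open>radj_sqr(6)\<close> replace \<open>F\<close> applied to \<open>radj\<close> by the original
  morphism or square.\<close>

lemma double_functor_radj: "double_functor A X radj"
proof (unfold_locales, goal_cases)
  case (5 C) then show ?case by (intro hor_uniq[of C]) simp_all
next
  case (7 j) then show ?case by (intro sqr_uniq[of j]) simp_all
next
  case (8 f) then show ?case
    \<comment> \<open>\<open>es_vid\<close> rewrites the counit square to
      \<open>iv A (e (hcod A f))\<close>, a form that \<open>radj_sqr(6)\<close> no longer matches;
      hence the explicit instance.\<close>
    using radj_sqr(6)[of "iv A f" "vid A (hcod A f)"]
    by (intro sqr_uniq[of "vid A (hcod A f)"]) simp_all
next
  case (9 f g) then show ?case
    \<comment> \<open>Bracketing to the right lets the counit pass \<open>g\<close>; bracketing to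
      the left then lets it pass \<open>f\<close>.\<close>
    by (intro hor_uniq[of "hcod A g"]) (simp_all add: F.A.H.cmp_assoc, simp flip: F.A.H.cmp_assoc)
next
  case (11 \<alpha> \<beta>) then show ?case
    by (intro sqr_uniq[of "sright A \<beta>"]) (simp_all add: F.A.SH.cmp_assoc, simp flip: F.A.SH.cmp_assoc)
next
  case (12 \<alpha> \<beta>) then show ?case
    \<comment> \<open>\<open>es_vcomp\<close> splits the counit square of the composite, and
      interchange compares the two rows separately.\<close>
    using F.A.sides_composable[OF 12] radj_sqr(6)[of "above A \<alpha> \<beta>" "vcomp A (sright A \<alpha>) (sright A \<beta>)"]
    by (intro sqr_uniq[of "vcomp A (sright A \<alpha>) (sright A \<beta>)"]) (simp_all flip: F.A.interchange)
qed simp_all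

sublocale radj: double_functor A X radj
  by (rule double_functor_radj)

text \<open>The laws of the unit and the triangle identities at \<open>radj\<close> are equations
  between morphisms or squares into values of \<open>radj\<close>, so they too are compared after
  composing with the counit. Naturality of the counit is \<open>radj_sqr(6)\<close>, and the
  triangle identities at \<open>F\<close> define the unit.\<close>

lemma horizontal_adjunction_radj: "horizontal_adjunction X A F radj radj_unit radj_counit"
proof -
  interpret I: double_functor X X dfun_id by (rule double_functor_id) (rule F.X.double_category_axioms)
  interpret J: double_functor A A dfun_id by (rule double_functor_id) (rule F.A.double_category_axioms)
  interpret FG: double_functor X X "dfun_comp F radj"
    by (rule double_functor_comp) (rule F.double_functor_axioms radj.double_functor_axioms)+
  interpret GF: double_functor A A "dfun_comp radj F"
    by (rule double_functor_comp) (rule F.double_functor_axioms radj.double_functor_axioms)+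
  show ?thesis
  proof (unfold_locales, goal_cases)
    case (3 C) then show ?case
      using radj_unit_sqr(6)[of "vid X C"] by (intro sqr_uniq[of "vid A (fob F C)"]) simp_all
  next
    case (4 j k) then show ?case
      using radj_unit_sqr(6)[of "vcomp X j k"]
      by (intro sqr_uniq[of "vcomp A (fver F j) (fver F k)"]) (simp_all flip: F.A.interchange)
  next
    case (5 \<alpha>) then show ?case
      by (intro sqr_uniq[of "fver F (sright X \<alpha>)"])
        (simp_all add: F.A.SH.cmp_assoc, simp flip: F.A.SH.cmp_assoc)
  next
    case (13 B) then show ?case
      by (intro hor_uniq[of B]) (simp_all add: F.A.H.cmp_assoc, simp flip: F.A.H.cmp_assoc)
  next
    case (14 k) then show ?case
      by (intro sqr_uniq[of k]) (simp_all add: F.A.SH.cmp_assoc, simp flip: F.A.SH.cmp_assoc)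
  qed simp_all
qed

end

section \<open>Adjunctions and representations\<close>

context horizontal_transformation
begin

declare tob [simp] tver [simp] tver_vid [simp] tver_vcomp [simp]

text \<open>Naturality is assumed for squares only; for a horizontal morphism it is the top boundary
  of naturality at \<open>iv X f\<close>.\<close>

lemma naturality_hor:
  assumes "f \<in> Hor X"
  shows "hcomp A (fhor F f) (tob \<theta> (hcod X f)) = hcomp A (tob \<theta> (hdom X f)) (fhor G f)"
  using arg_cong[OF naturality[of "iv X f"], of "stop A"] assms by simp

text \<open>Naturality inside a longer composite, in the right-bracketed form that rewriting with
  associativity produces.\<close>

lemma naturality_hor_assoc:
  assumes "f \<in> Hor X" "hcod X f = C" "g \<in> Hor A" "hdom A g = fob G C"
  shows "hcomp A (fhor F f) (hcomp A (tob \<theta> C) g) = hcomp A (tob \<theta> (hdom X f)) (hcomp A (fhor G f) g)"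
  using assms naturality_hor[of f] F.X.H.dom_cod_in[of f] by (simp flip: F.A.H.cmp_assoc)

lemma naturality_assoc:
  assumes "\<alpha> \<in> Sqr X" "sright X \<alpha> = k" "\<beta> \<in> Sqr A" "sleft A \<beta> = fver G k"
  shows "beside A (fsqr F \<alpha>) (beside A (tver \<theta> k) \<beta>) =
    beside A (tver \<theta> (sleft X \<alpha>)) (beside A (fsqr G \<alpha>) \<beta>)"
  using assms naturality[of \<alpha>] F.X.SH.dom_cod_in[of \<alpha>] by (simp flip: F.A.SH.cmp_assoc)

end

section \<open>From an adjunction to a representation\<close>

context horizontal_adjunction
begin

declare triangle_F_ob [simp] triangle_F_ver [simp] triangle_G_ob [simp] triangle_G_ver [simp]

definition transpose ::
    "('o \<times> 'o2, 'v \<times> 'v2, 'h2, 's2, 'h, 's) psh_map" where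
  "transpose = \<lparr>mapob = (\<lambda>(C, _) f. hcomp X (tob \<eta> C) (fhor G f)),
     mapver = (\<lambda>(j, _) \<alpha>. beside X (tver \<eta> j) (fsqr G \<alpha>))\<rparr>"

text \<open>The inverse of \<open>transpose\<close>, by naturality and the triangle
  identities.\<close>

definition cotranspose ::
    "('o \<times> 'o2, 'v \<times> 'v2, 'h, 's, 'h2, 's2) psh_map" where
  "cotranspose = \<lparr>mapob = (\<lambda>(_, B) g. hcomp A (fhor F g) (tob \<epsilon> B)),
     mapver = (\<lambda>(_, k) \<beta>. beside A (fsqr F \<beta>) (tver \<epsilon> k))\<rparr>"

lemma representable_hom_psh: "representable X (V1 A) (hom_psh A F dfun_id)"
proof -
  let ?P = "dprod (horop X) (V1 A)"
  let ?K = "hom_psh A F dfun_id"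
  let ?L = "hom_psh X dfun_id G"
  note G' = double_functor_V1[OF G.double_functor_axioms]
  interpret K: lax_span_functor ?P ?K
    by (rule lax_span_functor_hom_psh[OF F.double_functor_axioms
          double_functor_V1[OF counit.G.double_functor_axioms]])
  interpret L: lax_span_functor ?P ?L
    by (rule lax_span_functor_hom_psh[OF unit.F.double_functor_axioms G'])
  \<comment> \<open>Naturality in \<open>X\<close> is naturality of the unit; compatibility with
    vertical composition is interchange.\<close>
  have t: "psh_morphism ?P ?K ?L transpose"
    by unfold_locales
      (clarsimp simp: dprod_def horop_def hom_psh_def transpose_def F.A.V1_simps F.X.interchange
        F.X.H.cmp_assoc F.X.SH.cmp_assoc
        unit.naturality_hor_assoc[simplified] unit.naturality_assoc[simplified] F.A.sides_composable)+
  \<comment> \<open>Naturality in \<open>X\<close> is functoriality of \<open>F\<close>, and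
    naturality in \<open>V1 A\<close> is trivial because its squares are identities.\<close>
  have c: "psh_morphism ?P ?L ?K cotranspose"
    by unfold_locales
      (clarsimp simp: dprod_def horop_def hom_psh_def cotranspose_def F.A.V1_simps F.A.interchange
        F.A.H.cmp_assoc F.A.SH.cmp_assoc F.A.sides_composable)+
  \<comment> \<open>Naturality moves the counit to the left of \<open>f\<close>, next to the image
    of the unit, where the triangle identity at \<open>F\<close> cancels both.\<close>
  have ct: "hcomp A (fhor F (hcomp X (tob \<eta> C) (fhor G f))) (tob \<epsilon> B) = f"
    if "f \<in> Hor A" "C \<in> Obj X" "hdom A f = fob F C" "hcod A f = B" for f B C
  proof -
    have "hcomp A (fhor F (hcomp X (tob \<eta> C) (fhor G f))) (tob \<epsilon> B) =
        hcomp A (fhor F (tob \<eta> C)) (hcomp A (tob \<epsilon> (fob F C)) f)"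
      using that counit.naturality_hor[of f] F.A.H.dom_cod_in[of f] by (simp add: F.A.H.cmp_assoc)
    also have "\<dots> = f"
      using that by (simp flip: F.A.H.cmp_assoc)
    finally show ?thesis .
  qed
  have ct': "beside A (fsqr F (beside X (tver \<eta> j) (fsqr G \<alpha>))) (tver \<epsilon> k) = \<alpha>"
    if "\<alpha> \<in> Sqr A" "j \<in> Ver X" "sleft A \<alpha> = fver F j" "sright A \<alpha> = k" for \<alpha> j k
  proof -
    have "beside A (fsqr F (beside X (tver \<eta> j) (fsqr G \<alpha>))) (tver \<epsilon> k) =
        beside A (fsqr F (tver \<eta> j)) (beside A (tver \<epsilon> (fver F j)) \<alpha>)"
      using that counit.naturality[of \<alpha>] F.A.SH.dom_cod_in[of \<alpha>] by (simp add: F.A.SH.cmp_assoc)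
    also have "\<dots> = \<alpha>"
      using that by (simp flip: F.A.SH.cmp_assoc)
    finally show ?thesis .
  qed
  \<comment> \<open>Dually, naturality of the unit moves it past \<open>g\<close>, and the triangle
    identity at \<open>G\<close> applies.\<close>
  have tc: "hcomp X (tob \<eta> C) (fhor G (hcomp A (fhor F g) (tob \<epsilon> B))) = g"
    if "g \<in> Hor X" "B \<in> Obj A" "hdom X g = C" "hcod X g = fob G B" for g B C
    using that unit.naturality_hor_assoc[of g "fob G B" "fhor G (tob \<epsilon> B)"] by simp
  have tc': "beside X (tver \<eta> j) (fsqr G (beside A (fsqr F \<beta>) (tver \<epsilon> k))) = \<beta>"
    if "\<beta> \<in> Sqr X" "k \<in> Ver A" "sleft X \<beta> = j" "sright X \<beta> = fver G k" for \<beta> j k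
    using that unit.naturality_assoc[of \<beta> "fver G k" "fsqr G (tver \<epsilon> k)"] by simp
  have "psh_isomorphic ?P ?K ?L"
    unfolding psh_isomorphic_def
    by (intro exI[of _ transpose] exI[of _ cotranspose] conjI t c)
      \<comment> \<open>With these functor laws switched off, composites keep the form in which
        \<open>ct\<close>, \<open>ct'\<close>, \<open>tc\<close> and \<open>tc'\<close> state
        them.\<close>
      (auto simp: dprod_def horop_def hom_psh_def transpose_def cotranspose_def F.A.V1_simps
        simp del: F.fhor_hcomp F.fsqr_beside G.fhor_hcomp G.fsqr_beside intro: ct ct' tc tc')
  then show ?thesis
    unfolding representable_def using G' by blast
qed

end

section \<open>From a representation to a universal counit\<close>

locale representation =
  F: double_functor X A F + R: double_functor "V1 A" X G +
  \<sigma>: psh_morphism "dprod (horop X) (V1 A)" "hom_psh A F dfun_id" "hom_psh X dfun_id G" \<sigma> +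
  \<tau>: psh_morphism "dprod (horop X) (V1 A)" "hom_psh X dfun_id G" "hom_psh A F dfun_id" \<tau>
  for X :: "('o, 'h, 'v, 's) dcat" and A :: "('o2, 'h2, 'v2, 's2) dcat"
    and F :: "('o, 'h, 'v, 's, 'o2, 'h2, 'v2, 's2) dfun"
    and G :: "('o2, 'h2, 'v2, 's2, 'o, 'h, 'v, 's) dfun"
    and \<sigma> :: "('o \<times> 'o2, 'v \<times> 'v2, 'h2, 's2, 'h, 's) psh_map"
    and \<tau> :: "('o \<times> 'o2, 'v \<times> 'v2, 'h, 's, 'h2, 's2) psh_map" +
  assumes inv_ob: "C \<in> Obj (dprod (horop X) (V1 A)) \<Longrightarrow>
        (\<forall>x\<in>pob (hom_psh A F dfun_id) C. mapob \<tau> C (mapob \<sigma> C x) = x) \<and>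
        (\<forall>y\<in>pob (hom_psh X dfun_id G) C. mapob \<sigma> C (mapob \<tau> C y) = y)"
    and inv_ver: "j \<in> Ver (dprod (horop X) (V1 A)) \<Longrightarrow>
        (\<forall>x\<in>pver (hom_psh A F dfun_id) j. mapver \<tau> j (mapver \<sigma> j x) = x) \<and>
        (\<forall>y\<in>pver (hom_psh X dfun_id G) j. mapver \<sigma> j (mapver \<tau> j y) = y)"
begin

lemmas presheaf_simps = dprod_def horop_def hom_psh_def F.A.V1_simps

text \<open>The counit is read off the representation as the image of the identities, as in the
  Yoneda lemma.\<close>

definition e :: "'o2 \<Rightarrow> 'h2" where
  "e B = mapob \<tau> (fob G B, B) (hid X (fob G B))"

definition es :: "'v2 \<Rightarrow> 's2" where
  "es k = mapver \<tau> (fver G k, k) (ih X (fver G k))"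

text \<open>\<open>G\<close> is a double functor on \<open>V1 A\<close>, so its laws concern
  objects, vertical morphisms and identities of \<open>A\<close>; here they are restated in terms of
  \<open>A\<close> itself.\<close>

lemma G_simps:
  "B \<in> Obj A \<Longrightarrow> fob G B \<in> Obj X"
  "k \<in> Ver A \<Longrightarrow> fver G k \<in> Ver X"
  "k \<in> Ver A \<Longrightarrow> vdom X (fver G k) = fob G (vdom A k)"
  "k \<in> Ver A \<Longrightarrow> vcod X (fver G k) = fob G (vcod A k)"
  "B \<in> Obj A \<Longrightarrow> fver G (vid A B) = vid X (fob G B)"
  "B \<in> Obj A \<Longrightarrow> fhor G (hid A B) = hid X (fob G B)"
  "k \<in> Ver A \<Longrightarrow> fsqr G (ih A k) = ih X (fver G k)"
  "\<lbrakk>k \<in> Ver A; k' \<in> Ver A; vcod A k = vdom A k'\<rbrakk> \<Longrightarrow>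
    fver G (vcomp A k k') = vcomp X (fver G k) (fver G k')"
  using R.fob R.fver R.fver_vid R.fhor_hid R.fsqr_ih R.fver_vcomp by (simp_all add: F.A.V1_simps)

lemma \<tau>_ob:
  assumes "B \<in> Obj A" "g \<in> Hor X" "hcod X g = fob G B"
  shows "mapob \<tau> (hdom X g, B) g \<in> Hor A" "hdom A (mapob \<tau> (hdom X g, B) g) = fob F (hdom X g)"
    "hcod A (mapob \<tau> (hdom X g, B) g) = B"
  using \<tau>.mapob[of "(hdom X g, B)" g] assms by (auto simp: presheaf_simps)

lemma \<tau>_ver:
  assumes "k \<in> Ver A" "\<beta> \<in> Sqr X" "sright X \<beta> = fver G k" "j = sleft X \<beta>"
  shows "mapver \<tau> (j, k) \<beta> \<in> Sqr A" "sleft A (mapver \<tau> (j, k) \<beta>) = fver F j"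
    "sright A (mapver \<tau> (j, k) \<beta>) = k"
    "stop A (mapver \<tau> (j, k) \<beta>) = mapob \<tau> (vdom X j, vdom A k) (stop X \<beta>)"
    "sbot A (mapver \<tau> (j, k) \<beta>) = mapob \<tau> (vcod X j, vcod A k) (sbot X \<beta>)"
  using \<tau>.mapver[of "(j, k)" \<beta>] assms by (auto simp: presheaf_simps)

lemma e_simps:
  assumes "B \<in> Obj A"
  shows "e B \<in> Hor A" "hdom A (e B) = fob F (fob G B)" "hcod A (e B) = B"
  using assms \<tau>_ob[of B "hid X (fob G B)"] by (simp_all add: e_def G_simps)

lemma es_simps:
  assumes "k \<in> Ver A"
  shows "es k \<in> Sqr A" "sleft A (es k) = fver F (fver G k)" "sright A (es k) = k"
    "stop A (es k) = e (vdom A k)" "sbot A (es k) = e (vcod A k)"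
  using assms \<tau>_ver[of k "ih X (fver G k)" "fver G k"] by (simp_all add: e_def es_def G_simps)

text \<open>The Yoneda argument: \<open>g\<close> is the result of acting by
  \<open>(g, hid A B)\<close> on the identity of \<open>fob G B\<close>, and naturality carries this
  action over to \<open>e B\<close>.\<close>

lemma \<tau>_ob_eq:
  assumes "B \<in> Obj A" "g \<in> Hor X" "hcod X g = fob G B"
  shows "mapob \<tau> (hdom X g, B) g = hcomp A (fhor F g) (e B)"
  using \<tau>.natural_hor[of "(g, hid A B)" "hid X (fob G B)"] assms e_simps[of B]
  by (simp add: presheaf_simps G_simps e_def)

lemma \<tau>_ver_eq:
  assumes "k \<in> Ver A" "\<beta> \<in> Sqr X" "sright X \<beta> = fver G k"
  shows "mapver \<tau> (sleft X \<beta>, k) \<beta> = beside A (fsqr F \<beta>) (es k)"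
  using \<tau>.natural_sqr[of "(\<beta>, ih A k)" "ih X (fver G k)"] assms es_simps[of k]
  by (simp add: presheaf_simps G_simps es_def)

text \<open>By \<open>\<tau>_ob_eq\<close> and \<open>\<tau>_ver_eq\<close>, composing with the
  counit is \<open>\<tau>\<close>; its surjectivity gives existence of factorizations and its
  injectivity uniqueness. Compatibility of \<open>\<tau>\<close> with the comparison maps, at
  identities, gives the vertical laws of \<open>es\<close>.\<close>

lemma universal_counit: "universal_counit X A F (fob G) (fver G) e es"
proof (unfold_locales, goal_cases)
  case (7 B) then show ?case
    using \<tau>.map_punit[of "(fob G B, B)" "hid X (fob G B)"]
    by (simp add: presheaf_simps G_simps es_def e_def)
next
  case (8 k k') then show ?case
    using \<tau>.map_pcomp[of "(fver G k, k)" "(fver G k', k')" "ih X (fver G k)" "ih X (fver G k')"]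
    by (simp add: presheaf_simps G_simps es_def)
next
  case (9 f C)
  \<comment> \<open>The factorization is the preimage of \<open>f\<close> under
    \<open>\<tau>\<close>, supplied by its inverse \<open>\<sigma>\<close>.\<close>
  let ?g = "mapob \<sigma> (C, hcod A f) f"
  have g: "?g \<in> Hor X \<and> hdom X ?g = C \<and> hcod X ?g = fob G (hcod A f)"
    using 9 \<sigma>.mapob[of "(C, hcod A f)" f] by (auto simp: presheaf_simps)
  moreover have "mapob \<tau> (C, hcod A f) ?g = f"
    using 9 inv_ob[of "(C, hcod A f)"] by (auto simp: presheaf_simps)
  ultimately show ?case
    using \<tau>_ob_eq[of "hcod A f" ?g] 9 by (intro bexI[of _ ?g]) simp_all
next
  case (10 \<alpha> j)
  let ?\<beta> = "mapver \<sigma> (j, sright A \<alpha>) \<alpha>"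
  have g: "?\<beta> \<in> Sqr X \<and> sleft X ?\<beta> = j \<and> sright X ?\<beta> = fver G (sright A \<alpha>)"
    using 10 \<sigma>.mapver[of "(j, sright A \<alpha>)" \<alpha>] by (auto simp: presheaf_simps)
  moreover have "mapver \<tau> (j, sright A \<alpha>) ?\<beta> = \<alpha>"
    using 10 inv_ver[of "(j, sright A \<alpha>)"] by (auto simp: presheaf_simps)
  ultimately show ?case
    using \<tau>_ver_eq[of "sright A \<alpha>" ?\<beta>] 10 by (intro bexI[of _ ?\<beta>]) simp_all
next
  case (11 B g g')
  then have "mapob \<tau> (hdom X g, B) g = mapob \<tau> (hdom X g, B) g'"
    using \<tau>_ob_eq[of B g] \<tau>_ob_eq[of B g'] by simp
  then show ?case
    using 11 inv_ob[of "(hdom X g, B)"] by (simp add: presheaf_simps) metis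
next
  case (12 k \<beta> \<beta>')
  then have "mapver \<tau> (sleft X \<beta>, k) \<beta> = mapver \<tau> (sleft X \<beta>, k) \<beta>'"
    using \<tau>_ver_eq[of k \<beta>] \<tau>_ver_eq[of k \<beta>'] by simp
  then show ?case
    using 12 inv_ver[of "(sleft X \<beta>, k)"] by (simp add: presheaf_simps) metis
qed (simp_all add: G_simps e_simps es_simps)

end

lemma has_horizontal_right_adjoint_iff_representable:
  assumes "double_functor X A F"
  shows "has_horizontal_right_adjoint X A F \<longleftrightarrow> representable X (V1 A) (hom_psh A F dfun_id)"
proof
  assume "has_horizontal_right_adjoint X A F"
  then show "representable X (V1 A) (hom_psh A F dfun_id)"
    unfolding has_horizontal_right_adjoint_def using horizontal_adjunction.representable_hom_psh by blast
next
  assume "representable X (V1 A) (hom_psh A F dfun_id)"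
  then obtain G \<sigma> \<tau> where "representation X A F G \<sigma> \<tau>"
    using assms unfolding representable_def psh_isomorphic_def representation_def
      representation_axioms_def by metis
  then interpret representation X A F G \<sigma> \<tau> .
  \<comment> \<open>The adjoint obtained is \<open>radj\<close>, which agrees with \<open>G\<close>
    on objects and vertical morphisms and is defined anew on horizontal morphisms and
    squares.\<close>
  interpret universal_counit X A F "fob G" "fver G" e es
    by (rule universal_counit)
  show "has_horizontal_right_adjoint X A F"
    unfolding has_horizontal_right_adjoint_def using horizontal_adjunction_radj by blast
qed

section \<open>The double category of monads\<close>

context double_category
begin

section \<open>Pasting calculus\<close>

abbreviation beside_infix (infixr "\<parallel>" 75) where "\<alpha> \<parallel> \<beta> \<equiv> beside D \<alpha> \<beta>"
abbreviation above_infix (infixr "\<oslash>" 65) where "\<alpha> \<oslash> \<beta> \<equiv> above D \<alpha> \<beta>"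

text \<open>Since \<open>ih_vid_simp\<close> rewrites \<open>ih D (vid D A)\<close> to
  \<open>iv D (hid D A)\<close>, the unit laws for \<open>beside D\<close> are needed in that
  form.\<close>

lemma iv_hid_beside [simp]:
  "\<alpha> \<in> Sqr D \<Longrightarrow> sleft D \<alpha> = vid D A \<Longrightarrow> A \<in> Obj D \<Longrightarrow> iv D (hid D A) \<parallel> \<alpha> = \<alpha>"
  "\<alpha> \<in> Sqr D \<Longrightarrow> sright D \<alpha> = vid D A \<Longrightarrow> A \<in> Obj D \<Longrightarrow> \<alpha> \<parallel> iv D (hid D A) = \<alpha>"
  by (simp_all flip: ih_vid_simp)

text \<open>Interchange, with \<open>iv D f\<close> read as
  \<open>iv D f \<oslash> iv D f\<close>.\<close>

lemma whisker_left:
  assumes "f \<in> Hor D" "\<alpha> \<in> Sqr D" "\<beta> \<in> Sqr D" "sbot D \<alpha> = stop D \<beta>"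
    "sleft D \<alpha> = vid D (hcod D f)" "sleft D \<beta> = vid D (hcod D f)"
  shows "iv D f \<parallel> (\<alpha> \<oslash> \<beta>) = iv D f \<parallel> \<alpha> \<oslash> iv D f \<parallel> \<beta>"
  using assms by (simp add: interchange)

lemma whisker_right:
  assumes "f \<in> Hor D" "\<alpha> \<in> Sqr D" "\<beta> \<in> Sqr D" "sbot D \<alpha> = stop D \<beta>"
    "sright D \<alpha> = vid D (hdom D f)" "sright D \<beta> = vid D (hdom D f)"
  shows "(\<alpha> \<oslash> \<beta>) \<parallel> iv D f = \<alpha> \<parallel> iv D f \<oslash> \<beta> \<parallel> iv D f"
  using assms by (simp add: interchange)

text \<open>By interchange both sides equal \<open>\<alpha> \<parallel> \<beta>\<close>.\<close>

lemma slide: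
  assumes "\<alpha> \<in> Sqr D" "\<beta> \<in> Sqr D" "sright D \<alpha> = vid D B" "sleft D \<beta> = vid D B" "B \<in> Obj D"
  shows "iv D (stop D \<alpha>) \<parallel> \<beta> \<oslash> \<alpha> \<parallel> iv D (sbot D \<beta>) = \<alpha> \<parallel> iv D (stop D \<beta>) \<oslash> iv D (sbot D \<alpha>) \<parallel> \<beta>"
  using assms by (simp add: interchange)

text \<open>The unit of \<open>R\<close> is carried across \<open>G\<close> by
  \<open>\<psi>\<close>, where it becomes that of \<open>Q\<close>, and then across \<open>F\<close>
  by \<open>\<phi>\<close>.\<close>

lemma monad_map_comp_unit:
  assumes "F \<in> Hor D" "G \<in> Hor D" "hcod D F = hdom D G" "P \<in> Hor D" "Q \<in> Hor D" "R \<in> Hor D"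
    "hdom D P = hdom D F" "hcod D P = hdom D F" "hdom D Q = hcod D F" "hcod D Q = hcod D F"
    "hdom D R = hcod D G" "hcod D R = hcod D G"
    "square_with D \<phi> (vid D (hdom D F)) (vid D (hcod D F)) (hcomp D F Q) (hcomp D P F)"
    "square_with D \<psi> (vid D (hdom D G)) (vid D (hcod D G)) (hcomp D G R) (hcomp D Q G)"
    "square_with D \<eta>P (vid D (hdom D F)) (vid D (hdom D F)) (hid D (hdom D F)) P"
    "square_with D \<eta>Q (vid D (hcod D F)) (vid D (hcod D F)) (hid D (hcod D F)) Q"
    "square_with D \<eta>R (vid D (hcod D G)) (vid D (hcod D G)) (hid D (hcod D G)) R"
    and \<phi>: "iv D F \<parallel> \<eta>Q \<oslash> \<phi> = \<eta>P \<parallel> iv D F"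
    and \<psi>: "iv D G \<parallel> \<eta>R \<oslash> \<psi> = \<eta>Q \<parallel> iv D G"
  shows "iv D (hcomp D F G) \<parallel> \<eta>R \<oslash> (iv D F \<parallel> \<psi> \<oslash> \<phi> \<parallel> iv D G) = \<eta>P \<parallel> iv D (hcomp D F G)"
proof -
  \<comment> \<open>Identity squares on composites are split and rows bracketed to the right, which
    gives pastings a normal form.\<close>
  note [simp] = iv_hcomp SH.cmp_assoc H.cmp_assoc and [simp del] = beside_iv
  note [simp] = assms(1-17)[unfolded square_with_def]
  let ?F = "iv D F" and ?G = "iv D G"
  have "iv D (hcomp D F G) \<parallel> \<eta>R \<oslash> (?F \<parallel> \<psi> \<oslash> \<phi> \<parallel> ?G) = ?F \<parallel> (?G \<parallel> \<eta>R \<oslash> \<psi>) \<oslash> \<phi> \<parallel> ?G"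
    by (simp add: whisker_left SV.cmp_assoc)
  also have "\<dots> = (?F \<parallel> \<eta>Q \<oslash> \<phi>) \<parallel> ?G"
    unfolding \<psi> by (simp add: whisker_right)
  also have "\<dots> = \<eta>P \<parallel> iv D (hcomp D F G)"
    unfolding \<phi> by simp
  finally show ?thesis .
qed

text \<open>As for units, \<open>\<psi>\<close> and then \<open>\<phi>\<close> carry the
  multiplication across. Each leaves two copies of itself, and sorting these into two copies of the
  composite needs one exchange of \<open>\<phi>\<close> with \<open>\<psi>\<close>.\<close>

lemma monad_map_comp_mult:
  assumes "F \<in> Hor D" "G \<in> Hor D" "hcod D F = hdom D G" "P \<in> Hor D" "Q \<in> Hor D" "R \<in> Hor D"
    "hdom D P = hdom D F" "hcod D P = hdom D F" "hdom D Q = hcod D F" "hcod D Q = hcod D F"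
    "hdom D R = hcod D G" "hcod D R = hcod D G"
    "square_with D \<phi> (vid D (hdom D F)) (vid D (hcod D F)) (hcomp D F Q) (hcomp D P F)"
    "square_with D \<psi> (vid D (hdom D G)) (vid D (hcod D G)) (hcomp D G R) (hcomp D Q G)"
    "square_with D \<mu>P (vid D (hdom D F)) (vid D (hdom D F)) (hcomp D P P) P"
    "square_with D \<mu>Q (vid D (hcod D F)) (vid D (hcod D F)) (hcomp D Q Q) Q"
    "square_with D \<mu>R (vid D (hcod D G)) (vid D (hcod D G)) (hcomp D R R) R"
    and \<phi>: "iv D F \<parallel> \<mu>Q \<oslash> \<phi> = (\<phi> \<parallel> iv D Q \<oslash> iv D P \<parallel> \<phi>) \<oslash> \<mu>P \<parallel> iv D F"
    and \<psi>: "iv D G \<parallel> \<mu>R \<oslash> \<psi> = (\<psi> \<parallel> iv D R \<oslash> iv D Q \<parallel> \<psi>) \<oslash> \<mu>Q \<parallel> iv D G"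
  shows "iv D (hcomp D F G) \<parallel> \<mu>R \<oslash> (iv D F \<parallel> \<psi> \<oslash> \<phi> \<parallel> iv D G) =
    ((iv D F \<parallel> \<psi> \<oslash> \<phi> \<parallel> iv D G) \<parallel> iv D R \<oslash> iv D P \<parallel> (iv D F \<parallel> \<psi> \<oslash> \<phi> \<parallel> iv D G)) \<oslash>
      \<mu>P \<parallel> iv D (hcomp D F G)"
proof -
  note [simp] = iv_hcomp SH.cmp_assoc H.cmp_assoc and [simp del] = beside_iv
  note [simp] = assms(1-17)[unfolded square_with_def]
  let ?F = "iv D F" and ?G = "iv D G" and ?P = "iv D P" and ?Q = "iv D Q" and ?R = "iv D R"
  \<comment> \<open>\<open>\<phi>\<close> and \<open>\<psi>\<close> act on disjoint parts of the pasting, so their order can be exchanged.\<close>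
  have slid: "?F \<parallel> ?Q \<parallel> \<psi> \<oslash> \<phi> \<parallel> ?Q \<parallel> ?G = \<phi> \<parallel> ?G \<parallel> ?R \<oslash> ?P \<parallel> ?F \<parallel> \<psi>"
    using slide[of \<phi> \<psi> "hcod D F"] by simp
  have "iv D (hcomp D F G) \<parallel> \<mu>R \<oslash> (?F \<parallel> \<psi> \<oslash> \<phi> \<parallel> ?G) = ?F \<parallel> (?G \<parallel> \<mu>R \<oslash> \<psi>) \<oslash> \<phi> \<parallel> ?G"
    by (simp add: whisker_left SV.cmp_assoc)
  also have "\<dots> = ?F \<parallel> \<psi> \<parallel> ?R \<oslash> ?F \<parallel> ?Q \<parallel> \<psi> \<oslash> (?F \<parallel> \<mu>Q \<oslash> \<phi>) \<parallel> ?G"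
    unfolding \<psi> by (simp add: whisker_left whisker_right SV.cmp_assoc)
  also have "\<dots> = ?F \<parallel> \<psi> \<parallel> ?R \<oslash> (?F \<parallel> ?Q \<parallel> \<psi> \<oslash> \<phi> \<parallel> ?Q \<parallel> ?G) \<oslash> ?P \<parallel> \<phi> \<parallel> ?G \<oslash> \<mu>P \<parallel> ?F \<parallel> ?G"
    unfolding \<phi> by (simp add: whisker_left whisker_right SV.cmp_assoc)
  also have "\<dots> = ((?F \<parallel> \<psi> \<oslash> \<phi> \<parallel> ?G) \<parallel> ?R \<oslash> ?P \<parallel> (?F \<parallel> \<psi> \<oslash> \<phi> \<parallel> ?G)) \<oslash> \<mu>P \<parallel> iv D (hcomp D F G)"
    unfolding slid by (simp add: whisker_left whisker_right SV.cmp_assoc)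
  finally show ?thesis .
qed

text \<open>Whiskering expands both sides to the same three rows, containing \<open>\<chi>\<close>,
  \<open>\<psi>\<close> and \<open>\<phi>\<close> from top to bottom.\<close>

lemma monad_map_comp_assoc:
  assumes "F \<in> Hor D" "G \<in> Hor D" "H \<in> Hor D" "hcod D F = hdom D G" "hcod D G = hdom D H"
    "P \<in> Hor D" "Q \<in> Hor D" "R \<in> Hor D" "S \<in> Hor D"
    "hdom D P = hdom D F" "hcod D P = hdom D F" "hdom D Q = hcod D F" "hcod D Q = hcod D F"
    "hdom D R = hcod D G" "hcod D R = hcod D G" "hdom D S = hcod D H" "hcod D S = hcod D H"
    "square_with D \<phi> (vid D (hdom D F)) (vid D (hcod D F)) (hcomp D F Q) (hcomp D P F)"
    "square_with D \<psi> (vid D (hdom D G)) (vid D (hcod D G)) (hcomp D G R) (hcomp D Q G)"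
    "square_with D \<chi> (vid D (hdom D H)) (vid D (hcod D H)) (hcomp D H S) (hcomp D R H)"
  shows "iv D (hcomp D F G) \<parallel> \<chi> \<oslash> (iv D F \<parallel> \<psi> \<oslash> \<phi> \<parallel> iv D G) \<parallel> iv D H =
    iv D F \<parallel> (iv D G \<parallel> \<chi> \<oslash> \<psi> \<parallel> iv D H) \<oslash> \<phi> \<parallel> iv D (hcomp D G H)"
proof -
  note [simp] = iv_hcomp SH.cmp_assoc H.cmp_assoc and [simp del] = beside_iv
  note [simp] = assms[unfolded square_with_def]
  show ?thesis
    by (simp add: whisker_left whisker_right SV.cmp_assoc)
qed

text \<open>The vertical monad square moves to the right as it moves up: \<open>\<alpha>\<close>
  exchanges \<open>\<upsilon>u\<close> on its left for \<open>\<upsilon>v\<close> on its right, then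
  \<open>\<beta>\<close> exchanges \<open>\<upsilon>v\<close> for
  \<open>\<upsilon>w\<close>.\<close>

lemma monad_square_beside:
  assumes "F \<in> Hor D" "G \<in> Hor D" "hcod D F = hdom D G"
    "F' \<in> Hor D" "G' \<in> Hor D" "hcod D F' = hdom D G'"
    "P \<in> Hor D" "Q \<in> Hor D" "R \<in> Hor D" "P' \<in> Hor D" "Q' \<in> Hor D" "R' \<in> Hor D"
    "hdom D P = hdom D F" "hcod D P = hdom D F" "hdom D Q = hcod D F" "hcod D Q = hcod D F"
    "hdom D R = hcod D G" "hcod D R = hcod D G"
    "hdom D P' = hdom D F'" "hcod D P' = hdom D F'" "hdom D Q' = hcod D F'" "hcod D Q' = hcod D F'"
    "hdom D R' = hcod D G'" "hcod D R' = hcod D G'"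
    "u \<in> Ver D" "v \<in> Ver D" "w \<in> Ver D"
    "vdom D u = hdom D F" "vcod D u = hdom D F'" "vdom D v = hdom D G" "vcod D v = hdom D G'"
    "vdom D w = hcod D G" "vcod D w = hcod D G'"
    "square_with D \<phi> (vid D (hdom D F)) (vid D (hcod D F)) (hcomp D F Q) (hcomp D P F)"
    "square_with D \<psi> (vid D (hdom D G)) (vid D (hcod D G)) (hcomp D G R) (hcomp D Q G)"
    "square_with D \<phi>' (vid D (hdom D F')) (vid D (hcod D F')) (hcomp D F' Q') (hcomp D P' F')"
    "square_with D \<psi>' (vid D (hdom D G')) (vid D (hcod D G')) (hcomp D G' R') (hcomp D Q' G')"
    "square_with D \<upsilon>u u u P P'" "square_with D \<upsilon>v v v Q Q'" "square_with D \<upsilon>w w w R R'"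
    "square_with D \<alpha> u v F F'" "square_with D \<beta> v w G G'"
    and \<alpha>: "\<phi> \<oslash> \<upsilon>u \<parallel> \<alpha> = \<alpha> \<parallel> \<upsilon>v \<oslash> \<phi>'"
    and \<beta>: "\<psi> \<oslash> \<upsilon>v \<parallel> \<beta> = \<beta> \<parallel> \<upsilon>w \<oslash> \<psi>'"
  shows "(iv D F \<parallel> \<psi> \<oslash> \<phi> \<parallel> iv D G) \<oslash> \<upsilon>u \<parallel> \<alpha> \<parallel> \<beta> =
    (\<alpha> \<parallel> \<beta>) \<parallel> \<upsilon>w \<oslash> (iv D F' \<parallel> \<psi>' \<oslash> \<phi>' \<parallel> iv D G')"
proof -
  note [simp] = assms(1-42)[unfolded square_with_def]
  let ?F = "iv D F" and ?G = "iv D G" and ?F' = "iv D F'" and ?G' = "iv D G'"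
  \<comment> \<open>The hypothesis on \<open>\<alpha>\<close> is pasted with \<open>\<beta>\<close>,
    read first as \<open>?G \<oslash> \<beta>\<close> and then as
    \<open>\<beta> \<oslash> ?G'\<close>.\<close>
  have "\<phi> \<parallel> ?G \<oslash> (\<upsilon>u \<parallel> \<alpha>) \<parallel> \<beta> = (\<phi> \<oslash> \<upsilon>u \<parallel> \<alpha>) \<parallel> \<beta>"
    by (subst interchange) simp_all
  also have "\<dots> = (\<alpha> \<parallel> \<upsilon>v) \<parallel> \<beta> \<oslash> \<phi>' \<parallel> ?G'"
    unfolding \<alpha> by (subst interchange) simp_all
  finally have 1: "\<phi> \<parallel> ?G \<oslash> (\<upsilon>u \<parallel> \<alpha>) \<parallel> \<beta> = (\<alpha> \<parallel> \<upsilon>v) \<parallel> \<beta> \<oslash> \<phi>' \<parallel> ?G'" .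
  have "?F \<parallel> \<psi> \<oslash> \<alpha> \<parallel> (\<upsilon>v \<parallel> \<beta>) = \<alpha> \<parallel> (\<psi> \<oslash> \<upsilon>v \<parallel> \<beta>)"
    by (subst interchange) simp_all
  also have "\<dots> = \<alpha> \<parallel> (\<beta> \<parallel> \<upsilon>w) \<oslash> ?F' \<parallel> \<psi>'"
    unfolding \<beta> by (subst interchange) simp_all
  finally have 2: "?F \<parallel> \<psi> \<oslash> \<alpha> \<parallel> (\<upsilon>v \<parallel> \<beta>) = \<alpha> \<parallel> (\<beta> \<parallel> \<upsilon>w) \<oslash> ?F' \<parallel> \<psi>'" .
  have "(?F \<parallel> \<psi> \<oslash> \<phi> \<parallel> ?G) \<oslash> \<upsilon>u \<parallel> \<alpha> \<parallel> \<beta> = ?F \<parallel> \<psi> \<oslash> (\<phi> \<parallel> ?G \<oslash> (\<upsilon>u \<parallel> \<alpha>) \<parallel> \<beta>)"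
    by (simp add: SV.cmp_assoc SH.cmp_assoc H.cmp_assoc)
  also have "\<dots> = (?F \<parallel> \<psi> \<oslash> \<alpha> \<parallel> (\<upsilon>v \<parallel> \<beta>)) \<oslash> \<phi>' \<parallel> ?G'"
    unfolding 1 by (simp add: SV.cmp_assoc SH.cmp_assoc H.cmp_assoc)
  also have "\<dots> = (\<alpha> \<parallel> \<beta>) \<parallel> \<upsilon>w \<oslash> (?F' \<parallel> \<psi>' \<oslash> \<phi>' \<parallel> ?G')"
    unfolding 2 by (simp add: SV.cmp_assoc SH.cmp_assoc H.cmp_assoc)
  finally show ?thesis .
qed

end

section \<open>Monads, their morphisms and squares, and closure under composition\<close>

lemma Mnd_simps:
  "Obj (Mnd D) = {M. is_monad D M}" "Hor (Mnd D) = {f. is_mnd_hor D f}"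
  "Ver (Mnd D) = {j. is_mnd_ver D j}" "Sqr (Mnd D) = {\<alpha>. is_mnd_sqr D \<alpha>}"
  "hdom (Mnd D) = mh_dom" "hcod (Mnd D) = mh_cod" "vdom (Mnd D) = mv_dom" "vcod (Mnd D) = mv_cod"
  "sleft (Mnd D) = ms_left" "sright (Mnd D) = ms_right" "stop (Mnd D) = ms_top" "sbot (Mnd D) = ms_bot"
  "hid (Mnd D) = mnd_hid D" "vid (Mnd D) = mnd_vid D"
  "ih (Mnd D) = (\<lambda>j. MSqr j j (mnd_hid D (mv_dom j)) (mnd_hid D (mv_cod j)) (ih D (mv_ver j)))"
  "iv (Mnd D) = (\<lambda>f. MSqr (mnd_vid D (mh_dom f)) (mnd_vid D (mh_cod f)) f f (iv D (mh_hor f)))"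
  "hcomp (Mnd D) = mnd_hcomp D" "vcomp (Mnd D) = mnd_vcomp D"
  "beside (Mnd D) = (\<lambda>\<alpha> \<beta>. MSqr (ms_left \<alpha>) (ms_right \<beta>)
       (mnd_hcomp D (ms_top \<alpha>) (ms_top \<beta>)) (mnd_hcomp D (ms_bot \<alpha>) (ms_bot \<beta>))
       (beside D (ms_sqr \<alpha>) (ms_sqr \<beta>)))"
  "above (Mnd D) = (\<lambda>\<alpha> \<beta>. MSqr (mnd_vcomp D (ms_left \<alpha>) (ms_left \<beta>))
       (mnd_vcomp D (ms_right \<alpha>) (ms_right \<beta>)) (ms_top \<alpha>) (ms_bot \<beta>)
       (above D (ms_sqr \<alpha>) (ms_sqr \<beta>)))"
  by (simp_all add: Mnd_def)

context double_category
begin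

text \<open>The defining equations match on constructors; this selector form, like the three that
  follow, applies to variables.\<close>

lemma is_monad_iff: "is_monad D M \<longleftrightarrow>
    mob M \<in> Obj D \<and> mhor M \<in> Hor D \<and> hdom D (mhor M) = mob M \<and> hcod D (mhor M) = mob M \<and>
    square_with D (mmult M) (vid D (mob M)) (vid D (mob M)) (hcomp D (mhor M) (mhor M)) (mhor M) \<and>
    square_with D (munit M) (vid D (mob M)) (vid D (mob M)) (hid D (mob M)) (mhor M) \<and>
    mmult M \<parallel> iv D (mhor M) \<oslash> mmult M = iv D (mhor M) \<parallel> mmult M \<oslash> mmult M \<and>
    munit M \<parallel> iv D (mhor M) \<oslash> mmult M = iv D (mhor M) \<and>
    iv D (mhor M) \<parallel> munit M \<oslash> mmult M = iv D (mhor M)"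
  by (cases M) simp

lemma is_mnd_hor_iff: "is_mnd_hor D f \<longleftrightarrow>
    is_monad D (mh_dom f) \<and> is_monad D (mh_cod f) \<and>
    mh_hor f \<in> Hor D \<and> hdom D (mh_hor f) = mob (mh_dom f) \<and> hcod D (mh_hor f) = mob (mh_cod f) \<and>
    square_with D (mh_sqr f) (vid D (mob (mh_dom f))) (vid D (mob (mh_cod f)))
      (hcomp D (mh_hor f) (mhor (mh_cod f))) (hcomp D (mhor (mh_dom f)) (mh_hor f)) \<and>
    iv D (mh_hor f) \<parallel> munit (mh_cod f) \<oslash> mh_sqr f = munit (mh_dom f) \<parallel> iv D (mh_hor f) \<and>
    iv D (mh_hor f) \<parallel> mmult (mh_cod f) \<oslash> mh_sqr f =
      (mh_sqr f \<parallel> iv D (mhor (mh_cod f)) \<oslash> iv D (mhor (mh_dom f)) \<parallel> mh_sqr f) \<oslash>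
        mmult (mh_dom f) \<parallel> iv D (mh_hor f)"
  by (cases f, cases "mh_dom f", cases "mh_cod f") simp

lemma is_mnd_ver_iff: "is_mnd_ver D j \<longleftrightarrow>
    is_monad D (mv_dom j) \<and> is_monad D (mv_cod j) \<and>
    mv_ver j \<in> Ver D \<and> vdom D (mv_ver j) = mob (mv_dom j) \<and> vcod D (mv_ver j) = mob (mv_cod j) \<and>
    square_with D (mv_sqr j) (mv_ver j) (mv_ver j) (mhor (mv_dom j)) (mhor (mv_cod j)) \<and>
    munit (mv_dom j) \<oslash> mv_sqr j = ih D (mv_ver j) \<oslash> munit (mv_cod j) \<and>
    mmult (mv_dom j) \<oslash> mv_sqr j = mv_sqr j \<parallel> mv_sqr j \<oslash> mmult (mv_cod j)"
  by (cases j, cases "mv_dom j", cases "mv_cod j") simp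

lemma is_mnd_sqr_iff: "is_mnd_sqr D a \<longleftrightarrow>
    is_mnd_ver D (ms_left a) \<and> is_mnd_ver D (ms_right a) \<and>
    is_mnd_hor D (ms_top a) \<and> is_mnd_hor D (ms_bot a) \<and>
    mh_dom (ms_top a) = mv_dom (ms_left a) \<and> mh_dom (ms_bot a) = mv_cod (ms_left a) \<and>
    mh_cod (ms_top a) = mv_dom (ms_right a) \<and> mh_cod (ms_bot a) = mv_cod (ms_right a) \<and>
    square_with D (ms_sqr a) (mv_ver (ms_left a)) (mv_ver (ms_right a))
      (mh_hor (ms_top a)) (mh_hor (ms_bot a)) \<and>
    mh_sqr (ms_top a) \<oslash> mv_sqr (ms_left a) \<parallel> ms_sqr a =
      ms_sqr a \<parallel> mv_sqr (ms_right a) \<oslash> mh_sqr (ms_bot a)"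
  by (cases a) auto

lemma mnd_hcomp_eq: "mnd_hcomp D f g = MHor (mh_dom f) (mh_cod g) (hcomp D (mh_hor f) (mh_hor g))
    (iv D (mh_hor f) \<parallel> mh_sqr g \<oslash> mh_sqr f \<parallel> iv D (mh_hor g))"
  by (cases f; cases g) simp

lemma mnd_vcomp_eq: "mnd_vcomp D j k = MVer (mv_dom j) (mv_cod k) (vcomp D (mv_ver j) (mv_ver k))
    (mv_sqr j \<oslash> mv_sqr k)"
  by (cases j; cases k) simp

lemma monad_simps:
  assumes "is_monad D M"
  shows "mob M \<in> Obj D" "mhor M \<in> Hor D" "hdom D (mhor M) = mob M" "hcod D (mhor M) = mob M"
    "mmult M \<in> Sqr D" "sleft D (mmult M) = vid D (mob M)" "sright D (mmult M) = vid D (mob M)"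
    "stop D (mmult M) = hcomp D (mhor M) (mhor M)" "sbot D (mmult M) = mhor M"
    "munit M \<in> Sqr D" "sleft D (munit M) = vid D (mob M)" "sright D (munit M) = vid D (mob M)"
    "stop D (munit M) = hid D (mob M)" "sbot D (munit M) = mhor M"
  using assms by (simp_all add: is_monad_iff square_with_def)

lemma mnd_hor_simps:
  assumes "is_mnd_hor D f"
  shows "is_monad D (mh_dom f)" "is_monad D (mh_cod f)" "mh_hor f \<in> Hor D"
    "hdom D (mh_hor f) = mob (mh_dom f)" "hcod D (mh_hor f) = mob (mh_cod f)"
    "mh_sqr f \<in> Sqr D" "sleft D (mh_sqr f) = vid D (mob (mh_dom f))"
    "sright D (mh_sqr f) = vid D (mob (mh_cod f))"
    "stop D (mh_sqr f) = hcomp D (mh_hor f) (mhor (mh_cod f))"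
    "sbot D (mh_sqr f) = hcomp D (mhor (mh_dom f)) (mh_hor f)"
  using assms by (simp_all add: is_mnd_hor_iff square_with_def)

lemma mnd_ver_simps:
  assumes "is_mnd_ver D j"
  shows "is_monad D (mv_dom j)" "is_monad D (mv_cod j)" "mv_ver j \<in> Ver D"
    "vdom D (mv_ver j) = mob (mv_dom j)" "vcod D (mv_ver j) = mob (mv_cod j)"
    "mv_sqr j \<in> Sqr D" "sleft D (mv_sqr j) = mv_ver j" "sright D (mv_sqr j) = mv_ver j"
    "stop D (mv_sqr j) = mhor (mv_dom j)" "sbot D (mv_sqr j) = mhor (mv_cod j)"
  using assms by (simp_all add: is_mnd_ver_iff square_with_def)

lemma mnd_sqr_simps:
  assumes "is_mnd_sqr D a"
  shows "is_mnd_ver D (ms_left a)" "is_mnd_ver D (ms_right a)"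
    "is_mnd_hor D (ms_top a)" "is_mnd_hor D (ms_bot a)"
    "mh_dom (ms_top a) = mv_dom (ms_left a)" "mh_dom (ms_bot a) = mv_cod (ms_left a)"
    "mh_cod (ms_top a) = mv_dom (ms_right a)" "mh_cod (ms_bot a) = mv_cod (ms_right a)"
    "ms_sqr a \<in> Sqr D" "sleft D (ms_sqr a) = mv_ver (ms_left a)"
    "sright D (ms_sqr a) = mv_ver (ms_right a)"
    "stop D (ms_sqr a) = mh_hor (ms_top a)" "sbot D (ms_sqr a) = mh_hor (ms_bot a)"
  using assms by (simp_all add: is_mnd_sqr_iff square_with_def)

lemmas mnd_simps = monad_simps mnd_hor_simps mnd_ver_simps mnd_sqr_simps

lemma is_mnd_hor_hid: "is_monad D M \<Longrightarrow> is_mnd_hor D (mnd_hid D M)"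
  by (simp add: is_mnd_hor_iff mnd_hid_def mnd_simps square_with_def del: beside_iv)
    (simp add: is_monad_iff square_with_def)

lemma is_mnd_ver_vid: "is_monad D M \<Longrightarrow> is_mnd_ver D (mnd_vid D M)"
  by (simp add: is_mnd_ver_iff mnd_vid_def mnd_simps square_with_def)

lemma is_mnd_hor_hcomp:
  assumes "is_mnd_hor D f" "is_mnd_hor D g" "mh_cod f = mh_dom g"
  shows "is_mnd_hor D (mnd_hcomp D f g)"
proof -
  let ?f = "mnd_hcomp D f g"
  let ?F = "mh_hor f" and ?G = "mh_hor g"
  note s = mnd_simps assms square_with_def mnd_hcomp_eq
  have "iv D (mh_hor ?f) \<parallel> munit (mh_cod ?f) \<oslash> mh_sqr ?f = munit (mh_dom ?f) \<parallel> iv D (mh_hor ?f)"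
    unfolding mnd_hcomp_eq mnd_hor.sel
    by (rule monad_map_comp_unit[where P = "mhor (mh_dom f)" and Q = "mhor (mh_dom g)"
          and R = "mhor (mh_cod g)" and \<eta>Q = "munit (mh_dom g)"])
      (simp_all add: s del: beside_iv, use assms in \<open>simp_all add: is_mnd_hor_iff\<close>)
  moreover have "iv D (mh_hor ?f) \<parallel> mmult (mh_cod ?f) \<oslash> mh_sqr ?f =
      (mh_sqr ?f \<parallel> iv D (mhor (mh_cod ?f)) \<oslash> iv D (mhor (mh_dom ?f)) \<parallel> mh_sqr ?f) \<oslash>
        mmult (mh_dom ?f) \<parallel> iv D (mh_hor ?f)"
    unfolding mnd_hcomp_eq mnd_hor.sel
    by (rule monad_map_comp_mult[where Q = "mhor (mh_dom g)" and \<mu>Q = "mmult (mh_dom g)"])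
      (simp_all add: s del: beside_iv, use assms in \<open>simp_all add: is_mnd_hor_iff\<close>)
  ultimately show ?thesis
    unfolding is_mnd_hor_iff by (simp add: s H.cmp_assoc)
qed

text \<open>The unit and multiplication pass first through the square of \<open>j\<close>, then
  through that of \<open>k\<close>; for multiplication, interchange merges the doubled rows.\<close>

lemma is_mnd_ver_vcomp:
  assumes "is_mnd_ver D j" "is_mnd_ver D k" "mv_cod j = mv_dom k"
  shows "is_mnd_ver D (mnd_vcomp D j k)"
proof -
  note s = mnd_simps assms square_with_def mnd_vcomp_eq
  let ?M = "mv_dom j" and ?N = "mv_dom k" and ?L = "mv_cod k"
  have j: "munit ?M \<oslash> mv_sqr j = ih D (mv_ver j) \<oslash> munit ?N"
    "mmult ?M \<oslash> mv_sqr j = mv_sqr j \<parallel> mv_sqr j \<oslash> mmult ?N"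
    using assms(1,3) by (simp_all add: is_mnd_ver_iff)
  have k: "munit ?N \<oslash> mv_sqr k = ih D (mv_ver k) \<oslash> munit ?L"
    "mmult ?N \<oslash> mv_sqr k = mv_sqr k \<parallel> mv_sqr k \<oslash> mmult ?L"
    using assms(2) by (simp_all add: is_mnd_ver_iff)
  have "munit ?M \<oslash> mv_sqr j \<oslash> mv_sqr k = ih D (mv_ver j) \<oslash> (munit ?N \<oslash> mv_sqr k)"
    using j(1) by (simp add: s flip: SV.cmp_assoc)
  also have "\<dots> = ih D (vcomp D (mv_ver j) (mv_ver k)) \<oslash> munit ?L"
    unfolding k by (simp add: s ih_vcomp SV.cmp_assoc del: above_ih)
  finally have 1: "munit ?M \<oslash> mv_sqr j \<oslash> mv_sqr k = ih D (vcomp D (mv_ver j) (mv_ver k)) \<oslash> munit ?L" .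
  have "mmult ?M \<oslash> mv_sqr j \<oslash> mv_sqr k = mv_sqr j \<parallel> mv_sqr j \<oslash> (mmult ?N \<oslash> mv_sqr k)"
    using j(2) by (simp add: s flip: SV.cmp_assoc)
  also have "\<dots> = (mv_sqr j \<oslash> mv_sqr k) \<parallel> (mv_sqr j \<oslash> mv_sqr k) \<oslash> mmult ?L"
    unfolding k by (simp add: s SV.cmp_assoc flip: interchange)
  finally show ?thesis
    using 1 unfolding is_mnd_ver_iff by (simp add: s)
qed

lemma is_mnd_sqr_ih:
  "is_mnd_ver D j \<Longrightarrow>
    is_mnd_sqr D (MSqr j j (mnd_hid D (mv_dom j)) (mnd_hid D (mv_cod j)) (ih D (mv_ver j)))"
  by (simp add: is_mnd_sqr_iff is_mnd_hor_hid mnd_simps square_with_def) (simp add: mnd_hid_def mnd_simps)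

lemma is_mnd_sqr_iv:
  "is_mnd_hor D f \<Longrightarrow>
    is_mnd_sqr D (MSqr (mnd_vid D (mh_dom f)) (mnd_vid D (mh_cod f)) f f (iv D (mh_hor f)))"
  by (simp add: is_mnd_sqr_iff is_mnd_ver_vid mnd_simps square_with_def) (simp add: mnd_vid_def mnd_simps)

lemma is_mnd_sqr_beside:
  assumes "is_mnd_sqr D a" "is_mnd_sqr D b" "ms_right a = ms_left b"
  shows "is_mnd_sqr D (beside (Mnd D) a b)"
proof -
  note s = mnd_simps assms square_with_def
  have "mh_sqr (mnd_hcomp D (ms_top a) (ms_top b)) \<oslash> mv_sqr (ms_left a) \<parallel> ms_sqr a \<parallel> ms_sqr b =
      (ms_sqr a \<parallel> ms_sqr b) \<parallel> mv_sqr (ms_right b) \<oslash> mh_sqr (mnd_hcomp D (ms_bot a) (ms_bot b))"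
    unfolding mnd_hcomp_eq mnd_hor.sel
    by (rule monad_square_beside[where u = "mv_ver (ms_left a)" and v = "mv_ver (ms_left b)"
          and w = "mv_ver (ms_right b)" and \<upsilon>v = "mv_sqr (ms_left b)"
          and P = "mhor (mv_dom (ms_left a))" and P' = "mhor (mv_cod (ms_left a))"
          and Q = "mhor (mv_dom (ms_left b))" and Q' = "mhor (mv_cod (ms_left b))"
          and R = "mhor (mv_dom (ms_right b))" and R' = "mhor (mv_cod (ms_right b))"])
      (simp_all add: s, use assms in \<open>simp_all add: is_mnd_sqr_iff\<close>)
  then show ?thesis
    unfolding is_mnd_sqr_iff by (simp add: s Mnd_simps is_mnd_hor_hcomp) (simp add: s mnd_hcomp_eq)
qed

lemma mnd_sides_composable:
  assumes "is_mnd_sqr D a" "is_mnd_sqr D b" "ms_bot a = ms_top b"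
  shows "mv_cod (ms_left a) = mv_dom (ms_left b)" "mv_cod (ms_right a) = mv_dom (ms_right b)"
  using assms mnd_sqr_simps(5-8) by metis+

lemma is_mnd_sqr_above:
  assumes "is_mnd_sqr D a" "is_mnd_sqr D b" "ms_bot a = ms_top b"
  shows "is_mnd_sqr D (above (Mnd D) a b)"
proof -
  note c = mnd_sides_composable[OF assms]
  note s = mnd_simps assms c square_with_def
  have "mh_sqr (ms_top a) \<oslash> (mv_sqr (ms_left a) \<oslash> mv_sqr (ms_left b)) \<parallel> (ms_sqr a \<oslash> ms_sqr b) =
      (mh_sqr (ms_top a) \<oslash> mv_sqr (ms_left a) \<parallel> ms_sqr a) \<oslash> mv_sqr (ms_left b) \<parallel> ms_sqr b"
    by (simp add: s SV.cmp_assoc flip: interchange)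
  also have "\<dots> = (ms_sqr a \<parallel> mv_sqr (ms_right a) \<oslash> mh_sqr (ms_top b)) \<oslash> mv_sqr (ms_left b) \<parallel> ms_sqr b"
    using assms by (simp add: is_mnd_sqr_iff)
  also have "\<dots> = ms_sqr a \<parallel> mv_sqr (ms_right a) \<oslash> (mh_sqr (ms_top b) \<oslash> mv_sqr (ms_left b) \<parallel> ms_sqr b)"
    by (simp add: s SV.cmp_assoc)
  also have "\<dots> = ms_sqr a \<parallel> mv_sqr (ms_right a) \<oslash> (ms_sqr b \<parallel> mv_sqr (ms_right b) \<oslash> mh_sqr (ms_bot b))"
    using assms by (simp add: is_mnd_sqr_iff)
  also have "\<dots> = (ms_sqr a \<oslash> ms_sqr b) \<parallel> (mv_sqr (ms_right a) \<oslash> mv_sqr (ms_right b)) \<oslash> mh_sqr (ms_bot b)"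
    by (simp add: s SV.cmp_assoc flip: interchange)
  finally show ?thesis
    unfolding is_mnd_sqr_iff by (simp add: s Mnd_simps is_mnd_ver_vcomp) (simp add: s mnd_vcomp_eq)
qed

lemma mnd_hcomp_assoc:
  assumes "is_mnd_hor D f" "is_mnd_hor D g" "is_mnd_hor D h" "mh_cod f = mh_dom g" "mh_cod g = mh_dom h"
  shows "mnd_hcomp D (mnd_hcomp D f g) h = mnd_hcomp D f (mnd_hcomp D g h)"
proof -
  note s = mnd_simps assms square_with_def
  show ?thesis
    unfolding mnd_hcomp_eq mnd_hor.sel mnd_hor.inject
    by (intro conjI refl monad_map_comp_assoc[where P = "mhor (mh_dom f)" and Q = "mhor (mh_dom g)"
          and R = "mhor (mh_dom h)" and S = "mhor (mh_cod h)"])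
      (simp_all add: s H.cmp_assoc)
qed

lemma mnd_vcomp_assoc:
  assumes "is_mnd_ver D f" "is_mnd_ver D g" "is_mnd_ver D h" "mv_cod f = mv_dom g" "mv_cod g = mv_dom h"
  shows "mnd_vcomp D (mnd_vcomp D f g) h = mnd_vcomp D f (mnd_vcomp D g h)"
  using assms by (simp add: mnd_vcomp_eq mnd_simps V.cmp_assoc SV.cmp_assoc)

lemma mnd_hid_hcomp: "is_mnd_hor D f \<Longrightarrow> mh_dom f = M \<Longrightarrow> mnd_hcomp D (mnd_hid D M) f = f"
  by (rule mnd_hor.expand) (auto simp: mnd_hcomp_eq mnd_hid_def mnd_simps)

lemma mnd_hcomp_hid: "is_mnd_hor D f \<Longrightarrow> mh_cod f = M \<Longrightarrow> mnd_hcomp D f (mnd_hid D M) = f"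
  by (rule mnd_hor.expand) (auto simp: mnd_hcomp_eq mnd_hid_def mnd_simps)

lemma mnd_vid_vcomp: "is_mnd_ver D j \<Longrightarrow> mv_dom j = M \<Longrightarrow> mnd_vcomp D (mnd_vid D M) j = j"
  by (rule mnd_ver.expand) (auto simp: mnd_vcomp_eq mnd_vid_def mnd_simps)

lemma mnd_vcomp_vid: "is_mnd_ver D j \<Longrightarrow> mv_cod j = M \<Longrightarrow> mnd_vcomp D j (mnd_vid D M) = j"
  by (rule mnd_ver.expand) (auto simp: mnd_vcomp_eq mnd_vid_def mnd_simps)

lemma hid_vid_sel [simp]:
  "mh_dom (mnd_hid D M) = M" "mh_cod (mnd_hid D M) = M" "mh_hor (mnd_hid D M) = hid D (mob M)"
  "mv_dom (mnd_vid D M) = M" "mv_cod (mnd_vid D M) = M" "mv_ver (mnd_vid D M) = vid D (mob M)"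
  by (simp_all add: mnd_hid_def mnd_vid_def)

lemma comp_sel [simp]:
  "mh_dom (mnd_hcomp D f g) = mh_dom f" "mh_cod (mnd_hcomp D f g) = mh_cod g"
  "mh_hor (mnd_hcomp D f g) = hcomp D (mh_hor f) (mh_hor g)"
  "mv_dom (mnd_vcomp D j k) = mv_dom j" "mv_cod (mnd_vcomp D j k) = mv_cod k"
  "mv_ver (mnd_vcomp D j k) = vcomp D (mv_ver j) (mv_ver k)"
  by (simp_all add: mnd_hcomp_eq mnd_vcomp_eq)

text \<open>Equality of squares is componentwise: boundaries are handled by the laws for monad
  morphisms, underlying squares by those of \<open>D\<close>.\<close>

lemma double_category_Mnd: "double_category (Mnd D)"
proof -
  note closed = is_mnd_hor_hid is_mnd_ver_vid is_mnd_hor_hcomp is_mnd_ver_vcomp is_mnd_sqr_ih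
    is_mnd_sqr_iv is_mnd_sqr_beside[unfolded Mnd_simps] is_mnd_sqr_above[unfolded Mnd_simps]
  note laws = mnd_hid_hcomp mnd_hcomp_hid mnd_vid_vcomp mnd_vcomp_vid mnd_hcomp_assoc mnd_vcomp_assoc
  show ?thesis
    by unfold_locales
      \<comment> \<open>\<open>is_mnd_sqr.simps\<close> would unfold the membership statements that
        \<open>closed\<close> settles as they stand.\<close>
      (auto simp: Mnd_simps closed laws mnd_simps mnd_sides_composable SH.cmp_assoc SV.cmp_assoc interchange
         simp del: is_mnd_sqr.simps intro!: mnd_sqr.expand)
qed

section \<open>The inclusion of identity monads\<close>

lemma is_monad_id: "C \<in> Obj D \<Longrightarrow> is_monad D (id_monad D C)"
  by (simp add: id_monad_def square_with_def)

lemma id_monad_sel [simp]: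
  "mob (id_monad D C) = C" "mhor (id_monad D C) = hid D C"
  "mmult (id_monad D C) = iv D (hid D C)" "munit (id_monad D C) = iv D (hid D C)"
  by (simp_all add: id_monad_def)

lemma is_mnd_hor_inc: "f \<in> Hor D \<Longrightarrow> is_mnd_hor D (inc_hor D f)"
  by (simp add: inc_hor_def is_mnd_hor_iff is_monad_id square_with_def)

lemma is_mnd_ver_inc: "j \<in> Ver D \<Longrightarrow> is_mnd_ver D (inc_ver D j)"
  by (simp add: inc_ver_def is_mnd_ver_iff is_monad_id square_with_def flip: ih_vid_simp)

lemma double_functor_Inc: "double_functor D (Mnd D) (Inc D)"
proof -
  interpret M: double_category "Mnd D" by (rule double_category_Mnd)
  show ?thesis
  proof (unfold_locales, goal_cases)
    \<comment> \<open>Membership is settled while \<open>inc_hor\<close> and \<open>inc_ver\<close>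
      are folded; unfolding them then settles boundaries and compatibility.\<close>
    case (4 \<alpha>) then show ?case
      by (simp add: Mnd_simps Inc_def is_mnd_sqr_iff is_mnd_hor_inc is_mnd_ver_inc)
       (simp add: inc_hor_def inc_ver_def square_with_def)
  qed (simp_all add: Mnd_simps Inc_def is_monad_id is_mnd_hor_inc is_mnd_ver_inc,
      simp_all add: inc_hor_def inc_ver_def mnd_hid_def mnd_vid_def sides_composable ends_composable)
qed

end

theorem theorem10p3:
  fixes D :: "('o, 'h, 'v, 's) dcat"
  assumes "double_category D"
  shows "has_horizontal_right_adjoint D (Mnd D) (Inc D) \<longleftrightarrow>
         representable D (V1 (Mnd D)) (Alg D)"
  unfolding Alg_def
  by (rule has_horizontal_right_adjoint_iff_representable[OF double_category.double_functor_Inc[OF assms]])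

end
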